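(* Let $n,m\geq 1$ be integers. Let $D=\mathrm{diag}(\nu_1,\ldots,\nu_m)$ be an $m\times m$ diagonal matrix with $\nu_i>0$ for all $i=1,\ldots,m$. Let $A$ be a real $m\times m$ matrix such that (i) $\langle (D^{-1}A+AD^{-1})v,v\rangle\geq 0$ for all $v\in\mathbb{R}^m$; (ii) there is a constant $c>0$ with $\langle Av,v\rangle\geq c|v|^2$ for all $v\in\mathbb{R}^m$. Assume that $u=(u^1,\ldots,u^m)\in C^2(\mathbb{R}^n;\mathbb{R}^m)\cap L^\infty(\mathbb{R}^n;\mathbb{R}^m)$ is a solution on all of $\mathbb{R}^n$ of the system $$D\Delta u+[1-\langle Au,u\rangle]u=0.$$ Then there is a constant $C>0$, depending only on $A$, $D$ and $\|u\|_{L^\infty(\mathbb{R}^n;\mathbb{R}^m)}$, such that for every $x\in\mathbb{R}^n$ $$\sum_{j=1}^m\frac{\nu_j}{2}|\nabla u^j(x)|^2\leq C\,[1-\langle Au(x),u(x)\rangle].$$ In particular, $\langle Au(x),u(x)\rangle\leq 1$ for every $x\in\mathbb{R}^n$, and if $u$ is not constant, then $\langle Au(x),u(x)\rangle<1$ for every $x\in\mathbb{R}^n$.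
   Context: $|\cdot|$ and $\langle\cdot,\cdot\rangle$ denote the Euclidean norm and inner product; $\Delta u$ is the componentwise Laplacian. The matrix $A$ is not assumed symmetric. *)

theory Defs
  imports "HOL-Analysis.Analysis" "HOL-Probability.Essential_Supremum"
begin

text \<open>
  The dimension \<open>n\<close> of the domain is a natural number, not a type, because the constant in the
  theorem must be chosen uniformly in \<open>n\<close>. A point of \<open>\<real>\<^sup>n\<close> is an element of
  \<^term>\<open>{..<n} \<rightarrow>\<^sub>E (UNIV :: real set)\<close>, the common carrier of the product topology
  \<^term>\<open>powertop_real {..<n}\<close> and of the product Lebesgue measure. The dimension \<open>m\<close> of the
  target is the cardinality of an index type.
\<close>

abbreviation Rn :: "nat \<Rightarrow> (nat \<Rightarrow> real) set" where
  "Rn n \<equiv> {..<n} \<rightarrow>\<^sub>E UNIV"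

abbreviation lebesgue_Rn :: "nat \<Rightarrow> (nat \<Rightarrow> real) measure" where
  "lebesgue_Rn n \<equiv> PiM {..<n} (\<lambda>_. lborel)"

definition partial :: "nat \<Rightarrow> ((nat \<Rightarrow> real) \<Rightarrow> real) \<Rightarrow> (nat \<Rightarrow> real) \<Rightarrow> real" where
  "partial i f x = deriv (\<lambda>t. f (x(i := t))) (x i)"

primrec Ck :: "nat \<Rightarrow> nat \<Rightarrow> ((nat \<Rightarrow> real) \<Rightarrow> real) \<Rightarrow> bool" where
  "Ck n 0 f \<longleftrightarrow> continuous_map (powertop_real {..<n}) euclideanreal f"
| "Ck n (Suc k) f \<longleftrightarrow> continuous_map (powertop_real {..<n}) euclideanreal f \<and>
     (\<forall>i<n. (\<forall>x\<in>Rn n. (\<lambda>t. f (x(i := t))) field_differentiable (at (x i))) \<and>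
            Ck n k (partial i f))"

definition grad :: "nat \<Rightarrow> ((nat \<Rightarrow> real) \<Rightarrow> real) \<Rightarrow> (nat \<Rightarrow> real) \<Rightarrow> (nat \<Rightarrow> real)" where
  "grad n f x = (\<lambda>i\<in>{..<n}. partial i f x)"

definition laplacian :: "nat \<Rightarrow> ((nat \<Rightarrow> real) \<Rightarrow> real) \<Rightarrow> (nat \<Rightarrow> real) \<Rightarrow> real" where
  "laplacian n f x = (\<Sum>i<n. partial i (partial i f) x)"

definition vec_laplacian :: "nat \<Rightarrow> ((nat \<Rightarrow> real) \<Rightarrow> real ^ 'm) \<Rightarrow> (nat \<Rightarrow> real) \<Rightarrow> real ^ 'm" where
  "vec_laplacian n u x = (\<chi> j. laplacian n (\<lambda>y. u y $ j) x)"

definition Linf :: "nat \<Rightarrow> ((nat \<Rightarrow> real) \<Rightarrow> real ^ 'm) \<Rightarrow> bool" where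
  "Linf n u \<longleftrightarrow> u \<in> borel_measurable (lebesgue_Rn n) \<and>
     esssup (lebesgue_Rn n) (\<lambda>x. ereal (norm (u x))) < \<infinity>"

definition Linf_norm :: "nat \<Rightarrow> ((nat \<Rightarrow> real) \<Rightarrow> real ^ 'm) \<Rightarrow> real" where
  "Linf_norm n u = real_of_ereal (esssup (lebesgue_Rn n) (\<lambda>x. ereal (norm (u x))))"

definition diag :: "real ^ 'm \<Rightarrow> real ^ 'm ^ 'm" where
  "diag \<nu> = (\<chi> i j. if i = j then \<nu> $ i else 0)"

end

theory Submission
  imports Defs
begin

text \<open>
  Put \<open>w = 1 - \<langle>Au, u\<rangle>\<close>. Then \<open>\<Delta>w = b w - 2 \<Sum>\<^sub>i \<langle>A\<partial>\<^sub>iu, \<partial>\<^sub>iu\<rangle>\<close>, where \<open>b \<ge> 0\<close> by hypothesis (i).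
  Every estimate comes from one Liouville-type maximum principle on the whole space: a function
  that is bounded above and whose Laplacian is at least \<open>k > 0\<close> wherever it exceeds \<open>d\<close> never
  exceeds \<open>d\<close>. Applied to \<open>\<epsilon> \<langle>Du, u\<rangle>/2 - w\<close> it gives \<open>w \<ge> 0\<close>.

  Since \<open>u\<close> is only \<open>C\<^sup>2\<close>, and \<open>\<nabla>u\<close> is not known to be bounded, Bochner's formula is not available
  for \<open>\<nabla>u\<close>. It is applied to an increment \<open>d x = u (x + v) - u x\<close> instead: for \<open>C\<close> large,
  \<open>\<langle>Dd, d\<rangle>/2 - C |v|\<^sup>2 W\<close>, where \<open>W x\<close> is the mean of \<open>w\<close> over the segment from \<open>x\<close> to \<open>x + v\<close>,
  is nonpositive, because \<open>|d x|\<^sup>2\<close> is at most \<open>|v|\<^sup>2\<close> times the mean of \<open>|\<nabla>u|\<^sup>2\<close> over the segment.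
  Letting \<open>v\<close> shrink bounds each directional derivative with a constant that does not depend on
  \<open>n\<close>; the directions \<open>\<nabla>u\<^sup>j\<close>, \<open>j = 1, \<dots>, m\<close>, give the gradient bound at the cost of a factor \<open>m\<close>.
  If \<open>w\<close> vanishes somewhere, it vanishes identically by the strong maximum principle, and the
  bound on increments shows that \<open>u\<close> is constant.
\<close>

section \<open>Functions with second partial derivatives\<close>

text \<open>The derivatives are carried as explicit functions instead of through
  \<open>deriv\<close>, so that calculus rules build them symbolically and the Laplacian of a
  composite expression is read off as \<open>\<Sum>i<n. f2 i x\<close>.\<close>

definition partials2 ::
  "nat \<Rightarrow> ((nat \<Rightarrow> real) \<Rightarrow> 'b::real_normed_vector) \<Rightarrow> (nat \<Rightarrow> (nat \<Rightarrow> real) \<Rightarrow> 'b) \<Rightarrow>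
    (nat \<Rightarrow> (nat \<Rightarrow> real) \<Rightarrow> 'b) \<Rightarrow> bool" where
  "partials2 n f f1 f2 \<longleftrightarrow> (\<forall>x\<in>Rn n. \<forall>i<n.
     ((\<lambda>t. f (x(i := t))) has_vector_derivative f1 i x) (at (x i)) \<and>
     ((\<lambda>t. f1 i (x(i := t))) has_vector_derivative f2 i x) (at (x i)))"

text \<open>The restriction makes the value extensional, so it lies in \<open>Rn n\<close> for
  arbitrary \<open>v\<close> and \<open>x\<close>.\<close>

definition translate :: "nat \<Rightarrow> (nat \<Rightarrow> real) \<Rightarrow> (nat \<Rightarrow> real) \<Rightarrow> (nat \<Rightarrow> real)" where
  "translate n v x = (\<lambda>i\<in>{..<n}. x i + v i)"

lemma fun_upd_in_Rn: "x \<in> Rn n \<Longrightarrow> i < n \<Longrightarrow> x(i := t) \<in> Rn n"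
  by (auto simp: PiE_iff extensional_def)

lemma translate_in_Rn [simp]: "translate n v x \<in> Rn n"
  by (auto simp: translate_def)

lemma translate_fun_upd:
  "i < n \<Longrightarrow> translate n v (x(i := t)) = (translate n v x)(i := t + v i)"
  by (auto simp: translate_def fun_eq_iff)

text \<open>Applying the definition at the point \<open>x(i := t)\<close> gives the derivative along
  the whole coordinate line, as mean value and chain rule arguments require.\<close>

lemma partials2D:
  assumes "partials2 n f f1 f2" "x \<in> Rn n" "i < n"
  shows "((\<lambda>s. f (x(i := s))) has_vector_derivative f1 i (x(i := t))) (at t)"
    and "((\<lambda>s. f1 i (x(i := s))) has_vector_derivative f2 i (x(i := t))) (at t)"
proof -
  have "x(i := t) \<in> Rn n"
    by (rule fun_upd_in_Rn[OF assms(2,3)])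
  from assms(1)[unfolded partials2_def, rule_format, OF this assms(3)]
  have "((\<lambda>s. f (x(i := t, i := s))) has_vector_derivative f1 i (x(i := t))) (at ((x(i := t)) i)) \<and>
     ((\<lambda>s. f1 i (x(i := t, i := s))) has_vector_derivative f2 i (x(i := t))) (at ((x(i := t)) i))"
    by simp
  then show "((\<lambda>s. f (x(i := s))) has_vector_derivative f1 i (x(i := t))) (at t)"
    and "((\<lambda>s. f1 i (x(i := s))) has_vector_derivative f2 i (x(i := t))) (at t)"
    by simp_all
qed

lemma partials2_bilinear:
  assumes "bounded_bilinear B" "partials2 n f f1 f2" "partials2 n g g1 g2"
  shows "partials2 n (\<lambda>x. B (f x) (g x)) (\<lambda>i x. B (f x) (g1 i x) + B (f1 i x) (g x))
    (\<lambda>i x. B (f x) (g2 i x) + 2 *\<^sub>R B (f1 i x) (g1 i x) + B (f2 i x) (g x))"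
  unfolding partials2_def
proof (intro ballI allI impI conjI)
  fix x i assume x: "x \<in> Rn n" and i: "i < n"
  note d = partials2D[OF assms(2) x i, of "x i", simplified] partials2D[OF assms(3) x i, of "x i", simplified]
  note D = bounded_bilinear.has_vector_derivative[OF assms(1)]
  show "((\<lambda>t. B (f (x(i := t))) (g (x(i := t)))) has_vector_derivative
     B (f x) (g1 i x) + B (f1 i x) (g x)) (at (x i))"
    using D[OF d(1) d(3)] by simp
  show "((\<lambda>t. B (f (x(i := t))) (g1 i (x(i := t))) + B (f1 i (x(i := t))) (g (x(i := t))))
     has_vector_derivative
     B (f x) (g2 i x) + 2 *\<^sub>R B (f1 i x) (g1 i x) + B (f2 i x) (g x)) (at (x i))"
    using has_vector_derivative_add[OF D[OF d(1) d(4)] D[OF d(2) d(3)]]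
    by (simp add: scaleR_2 algebra_simps)
qed

lemma partials2_linear:
  assumes "bounded_linear L" "partials2 n f f1 f2"
  shows "partials2 n (\<lambda>x. L (f x)) (\<lambda>i x. L (f1 i x)) (\<lambda>i x. L (f2 i x))"
  using assms(2) bounded_linear.has_vector_derivative[OF assms(1)]
  unfolding partials2_def by blast

lemma partials2_const: "partials2 n (\<lambda>x. c) (\<lambda>i x. 0) (\<lambda>i x. 0)"
  unfolding partials2_def by auto

lemma partials2_diff:
  assumes "partials2 n f f1 f2" "partials2 n g g1 g2"
  shows "partials2 n (\<lambda>x. f x - g x) (\<lambda>i x. f1 i x - g1 i x) (\<lambda>i x. f2 i x - g2 i x)"
  using assms unfolding partials2_def by (auto intro!: has_vector_derivative_diff)

lemma partials2_translate:
  fixes f :: "(nat \<Rightarrow> real) \<Rightarrow> 'b::real_normed_vector"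
  assumes "partials2 n f f1 f2"
  shows "partials2 n (\<lambda>x. f (translate n v x)) (\<lambda>i x. f1 i (translate n v x))
    (\<lambda>i x. f2 i (translate n v x))"
  unfolding partials2_def
proof (intro ballI allI impI)
  fix x i assume x: "x \<in> Rn n" and i: "i < n"
  have *: "((\<lambda>t. h (t + c)) has_vector_derivative h') (at s)"
    if "(h has_vector_derivative h') (at (s + c))" for h :: "real \<Rightarrow> 'b::real_normed_vector" and h' s c
  proof -
    have "((\<lambda>t. t + c) has_vector_derivative 1) (at s)"
      by (auto intro!: derivative_eq_intros)
    from vector_diff_chain_at[OF this that] show ?thesis by (simp add: o_def)
  qed
  have tr: "translate n v x i = x i + v i"
    using i by (simp add: translate_def)
  show "((\<lambda>t. f (translate n v (x(i := t)))) has_vector_derivative f1 i (translate n v x)) (at (x i)) \<and>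
    ((\<lambda>t. f1 i (translate n v (x(i := t)))) has_vector_derivative f2 i (translate n v x)) (at (x i))"
    using *[OF partials2D(1)[OF assms translate_in_Rn i, of v x "x i + v i"]]
      *[OF partials2D(2)[OF assms translate_in_Rn i, of v x "x i + v i"]] i
    by (simp add: translate_fun_upd flip: tr)
qed

lemma partials2_compose_real:
  fixes f :: "(nat \<Rightarrow> real) \<Rightarrow> real" and h :: "real \<Rightarrow> real"
  assumes "partials2 n f f1 f2"
    and h1: "\<And>s. (h has_real_derivative h1 s) (at s)" and h2: "\<And>s. (h1 has_real_derivative h2 s) (at s)"
  shows "partials2 n (\<lambda>x. h (f x)) (\<lambda>i x. h1 (f x) * f1 i x)
    (\<lambda>i x. h2 (f x) * (f1 i x)\<^sup>2 + h1 (f x) * f2 i x)"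
  unfolding partials2_def
proof (intro ballI allI impI)
  fix x i assume x: "x \<in> Rn n" and i: "i < n"
  have d: "((\<lambda>t. f (x(i := t))) has_real_derivative f1 i x) (at (x i))"
    "((\<lambda>t. f1 i (x(i := t))) has_real_derivative f2 i x) (at (x i))"
    using partials2D[OF assms(1) x i, of "x i"]
    by (auto simp: has_real_derivative_iff_has_vector_derivative)
  have c: "((\<lambda>t. h (f (x(i := t)))) has_real_derivative h1 (f x) * f1 i x) (at (x i))"
    using DERIV_chain2[of h "h1 (f x)" "\<lambda>t. f (x(i := t))" "x i", OF _ d(1)] h1 by simp
  have c1: "((\<lambda>t. h1 (f (x(i := t)))) has_real_derivative h2 (f x) * f1 i x) (at (x i))"
    using DERIV_chain2[of h1 "h2 (f x)" "\<lambda>t. f (x(i := t))" "x i", OF _ d(1)] h2 by simp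
  show "((\<lambda>t. h (f (x(i := t)))) has_vector_derivative h1 (f x) * f1 i x) (at (x i)) \<and>
    ((\<lambda>t. h1 (f (x(i := t))) * f1 i (x(i := t))) has_vector_derivative
      h2 (f x) * (f1 i x)\<^sup>2 + h1 (f x) * f2 i x) (at (x i))"
    using c DERIV_mult[OF c1 d(2)]
    by (simp add: has_real_derivative_iff_has_vector_derivative[symmetric] power2_eq_square mult.assoc mult_ac)
qed

text \<open>The squared distance serves twice: as the penalty in the maximum principle and as the
  exponent of Hopf's barrier.\<close>

lemma partials2_sqdist:
  "partials2 n (\<lambda>x. \<Sum>k<n. (x k - y k)\<^sup>2) (\<lambda>i x. 2 * (x i - y i)) (\<lambda>i x. 2)"
  unfolding partials2_def
proof (intro ballI allI impI conjI)
  fix x i assume i: "i < (n::nat)"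
  have "((\<lambda>t. \<Sum>k<n. ((x(i := t)) k - y k)\<^sup>2) has_real_derivative
      (\<Sum>k<n. if k = i then 2 * (x i - y i) else 0)) (at (x i))"
  proof (intro DERIV_sum)
    fix k
    show "((\<lambda>t. ((x(i := t)) k - y k)\<^sup>2) has_real_derivative (if k = i then 2 * (x i - y i) else 0)) (at (x i))"
      by (cases "k = i") (auto intro!: derivative_eq_intros)
  qed
  then show "((\<lambda>t. \<Sum>k<n. ((x(i := t)) k - y k)\<^sup>2) has_vector_derivative 2 * (x i - y i)) (at (x i))"
    using i by (simp add: has_real_derivative_iff_has_vector_derivative)
  show "((\<lambda>t. 2 * ((x(i := t)) i - y i)) has_vector_derivative 2) (at (x i))"
    by (auto simp: has_real_derivative_iff_has_vector_derivative[symmetric] intro!: derivative_eq_intros)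
qed

section \<open>Continuity on \<open>Rn n\<close>\<close>

text \<open>On \<open>Rn n\<close> every coordinate beyond \<open>n\<close> is constantly
  \<open>undefined\<close>, so the product topology over \<open>{..<n}\<close> agrees with the
  subspace topology of the full function space. This opens the way to the rules for
  \<open>continuous_on\<close>.\<close>

lemma continuous_on_Rn_iff:
  "continuous_map (powertop_real {..<n}) euclidean f \<longleftrightarrow> continuous_on (Rn n) f"
proof
  have "continuous_map (top_of_set (Rn n)) (powertop_real {..<n}) (\<lambda>x. x)"
    unfolding continuous_map_componentwise
  proof (intro conjI ballI)
    show "continuous_map (top_of_set (Rn n)) euclideanreal (\<lambda>x. x k)" for k
      using continuous_on_subset[OF continuous_on_product_coordinates[of k] subset_UNIV] by simp
    show "(\<lambda>x. x) ` topspace (top_of_set (Rn n)) \<subseteq> extensional {..<n}"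
      by (simp add: PiE_def)
  qed
  moreover assume "continuous_map (powertop_real {..<n}) euclidean f"
  ultimately have "continuous_map (top_of_set (Rn n)) euclidean (f \<circ> (\<lambda>x. x))"
    by (rule continuous_map_compose)
  then show "continuous_on (Rn n) f"
    by (simp add: o_def)
next
  have "continuous_map (powertop_real {..<n}) (powertop_real UNIV) (\<lambda>x. x)"
    unfolding continuous_map_componentwise
  proof (intro conjI ballI)
    show "continuous_map (powertop_real {..<n}) euclideanreal (\<lambda>x. x k)" for k
    proof (cases "k < n")
      case True
      then show ?thesis
        using continuous_map_product_projection[of k "{..<n}" "\<lambda>_. euclideanreal"] by simp
    next
      case False
      have "continuous_map (powertop_real {..<n}) euclideanreal (\<lambda>x. undefined)"
        by simp
      then show ?thesis
        by (rule continuous_map_eq) (use False in \<open>auto simp: PiE_iff extensional_def\<close>)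
    qed
  qed simp
  then have "continuous_map (powertop_real {..<n}) (top_of_set (Rn n)) (\<lambda>x. x)"
    by (simp add: continuous_map_in_subtopology euclidean_product_topology)
  moreover assume "continuous_on (Rn n) f"
  then have "continuous_map (top_of_set (Rn n)) euclidean f"
    by simp
  ultimately have "continuous_map (powertop_real {..<n}) euclidean (f \<circ> (\<lambda>x. x))"
    by (rule continuous_map_compose)
  then show "continuous_map (powertop_real {..<n}) euclidean f"
    by (simp add: o_def)
qed

lemma continuous_on_coordinate [continuous_intros]: "continuous_on S (\<lambda>x :: nat \<Rightarrow> real. x i)"
  using continuous_on_subset[OF continuous_on_product_coordinates subset_UNIV] .

lemma continuous_on_translate [continuous_intros]:
  assumes "\<And>k. k < n \<Longrightarrow> continuous_on S (\<lambda>p. v p k)" "\<And>k. k < n \<Longrightarrow> continuous_on S (\<lambda>p. x p k)"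
  shows "continuous_on S (\<lambda>p. translate n (v p) (x p))"
proof (rule continuous_on_coordinatewise_then_product)
  fix k
  show "continuous_on S (\<lambda>p. translate n (v p) (x p) k)"
    by (cases "k < n") (simp_all add: translate_def assms continuous_on_add)
qed

section \<open>The maximum principle on the whole space\<close>

lemma openin_Rn_box:
  assumes "openin (powertop_real {..<n}) U" "x \<in> U"
  obtains r where "r > 0" "\<And>y. y \<in> Rn n \<Longrightarrow> (\<And>i. i < n \<Longrightarrow> \<bar>y i - x i\<bar> < r) \<Longrightarrow> y \<in> U"
proof -
  obtain V where V: "\<forall>i\<in>{..<n}. openin euclideanreal (V i)" "x \<in> PiE {..<n} V" "PiE {..<n} V \<subseteq> U"
    using assms(1)[unfolded openin_product_topology_alt, rule_format, OF assms(2)]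
    by (elim exE conjE)
  have "\<exists>e>0. \<forall>t. \<bar>t - x i\<bar> < e \<longrightarrow> t \<in> V i" if "i < n" for i
    using bspec[OF V(1), of i] PiE_mem[OF V(2), of i] that
    by (simp add: open_dist dist_real_def flip: open_openin)
  then obtain e where e: "\<And>i. i < n \<Longrightarrow> e i > 0" "\<And>i t. i < n \<Longrightarrow> \<bar>t - x i\<bar> < e i \<Longrightarrow> t \<in> V i"
    by metis
  \<comment> \<open>The inserted 1 keeps the minimum over a nonempty set when
    \<open>n = 0\<close>.\<close>
  define r where "r = Min (insert 1 (e ` {..<n}))"
  have "r > 0" unfolding r_def using e(1) by (subst Min_gr_iff) auto
  moreover have re: "r \<le> e i" if "i < n" for i
    unfolding r_def using that by (intro Min_le) auto
  have "y \<in> U" if "y \<in> Rn n" "\<And>i. i < n \<Longrightarrow> \<bar>y i - x i\<bar> < r" for y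
  proof -
    have "y \<in> PiE {..<n} V"
    proof (rule PiE_I)
      fix i assume "i \<in> {..<n}"
      then have i: "i < n" by simp
      then show "y i \<in> V i" using e(2)[OF i] that(2)[OF i] re[OF i] by simp
    qed (use that(1) in \<open>auto simp: PiE_iff extensional_def\<close>)
    then show ?thesis using V(3) by blast
  qed
  ultimately show ?thesis using that by blast
qed

lemma continuous_attains_max_box:
  fixes f :: "(nat \<Rightarrow> real) \<Rightarrow> real"
  assumes "continuous_on (Rn n) f" "\<And>i. i < n \<Longrightarrow> a i \<le> b i"
  obtains x where "x \<in> PiE {..<n} (\<lambda>i. {a i..b i})" "\<And>y. y \<in> PiE {..<n} (\<lambda>i. {a i..b i}) \<Longrightarrow> f y \<le> f x"
proof -
  let ?K = "PiE {..<n} (\<lambda>i. {a i..b i})"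
  have "compactin (powertop_real {..<n}) ?K"
    by (simp add: compactin_PiE)
  then have "compact (f ` ?K)"
    using image_compactin[OF _ assms(1)[folded continuous_on_Rn_iff]] by simp
  moreover have "?K \<noteq> {}"
    using assms(2) by (auto simp: PiE_eq_empty_iff)
  ultimately obtain s where "s \<in> f ` ?K" "\<And>t. t \<in> f ` ?K \<Longrightarrow> t \<le> s"
    using compact_attains_sup[of "f ` ?K"] by blast
  then show ?thesis using that by auto
qed

text \<open>If \<open>d\<close> were positive, \<open>f'\<close> would increase through its zero at
  \<open>a\<close> and be positive just to the right; the mean value theorem then lifts
  \<open>f\<close> above \<open>f a\<close>.\<close>

lemma second_derivative_nonpos_at_local_max:
  fixes f f' :: "real \<Rightarrow> real"
  assumes f: "\<And>t. (f has_real_derivative f' t) (at t)" and f': "(f' has_real_derivative d) (at a)"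
    and r: "r > 0" "\<And>t. \<bar>t - a\<bar> < r \<Longrightarrow> f t \<le> f a"
  shows "d \<le> 0"
proof (rule ccontr)
  assume "\<not> d \<le> 0"
  then obtain s where s: "s > 0" "\<And>h. 0 < h \<Longrightarrow> h < s \<Longrightarrow> f' a < f' (a + h)"
    using DERIV_pos_inc_right[OF f', of ] by auto
  have 0: "f' a = 0"
    by (rule DERIV_local_max[OF f r(1)]) (use r(2) in \<open>auto simp: abs_minus_commute\<close>)
  define h where "h = min s r / 2"
  have h: "0 < h" "h < s" "h < r" using s(1) r(1) by (auto simp: h_def min_def)
  obtain z where z: "a < z" "z < a + h" "f (a + h) - f a = (a + h - a) * f' z"
    using MVT2[of a "a + h" f f'] f h(1) by auto
  have "f' z > 0" using s(2)[of "z - a"] z h 0 by auto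
  then have "f (a + h) > f a" using z(3) h(1) by (smt (verit) mult_pos_pos)
  then show False using r(2)[of "a + h"] h by auto
qed

text \<open>\<open>f\<close> need not attain its supremum, but \<open>f - e |x - x0|\<^sup>2\<close> does, at a point where \<open>f\<close> is still at
  least \<open>f x0\<close>.\<close>

lemma bounded_subsolution_le:
  fixes f :: "(nat \<Rightarrow> real) \<Rightarrow> real"
  assumes cont: "continuous_on (Rn n) f" and D2: "partials2 n f f1 f2"
    and bdd: "\<And>x. x \<in> Rn n \<Longrightarrow> f x \<le> M"
    and k: "k > 0" "\<And>x. x \<in> Rn n \<Longrightarrow> f x > d \<Longrightarrow> (\<Sum>i<n. f2 i x) \<ge> k"
    and x0: "x0 \<in> Rn n"
  shows "f x0 \<le> d"
proof (rule ccontr)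
  assume neg: "\<not> f x0 \<le> d"
  \<comment> \<open>The penalty \<open>e |x - x0|\<^sup>2\<close> has Laplacian
    \<open>2 n e\<close>, which this choice keeps below \<open>k\<close>.\<close>
  define e where "e = k / (2 * n + 1)"
  have e: "e > 0" using k by (simp add: e_def)
  have ek: "2 * n * e < k"
    using k by (simp add: e_def field_simps)
  \<comment> \<open>At distance \<open>R\<close> from \<open>x0\<close> the penalty already pushes
    \<open>g\<close> below \<open>f x0\<close>; the summand 1 gives \<open>R \<le> R\<^sup>2\<close>
    and makes the inequality strict.\<close>
  define R where "R = (M - f x0) / e + 1"
  have R: "R \<ge> 1" using bdd[OF x0] e by (simp add: R_def)
  have "e * R \<le> e * R\<^sup>2" using R e by (simp add: power2_eq_square)
  moreover have "e * R = M - f x0 + e" using e by (simp add: R_def field_simps)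
  ultimately have eR: "M - e * R\<^sup>2 < f x0" using e by linarith
  define g where "g x = f x - e * (\<Sum>k<n. (x k - x0 k)\<^sup>2)" for x
  have gc: "continuous_on (Rn n) g"
    unfolding g_def by (intro continuous_intros cont)
  define K where "K = PiE {..<n} (\<lambda>i. {x0 i - R..x0 i + R})"
  obtain y where y: "y \<in> K" "\<And>x. x \<in> K \<Longrightarrow> g x \<le> g y"
    using continuous_attains_max_box[OF gc, of "\<lambda>i. x0 i - R" "\<lambda>i. x0 i + R"] R unfolding K_def by auto
  have yR: "y \<in> Rn n" using y(1) by (auto simp: K_def PiE_iff)
  have "x0 \<in> K" using x0 R by (auto simp: K_def PiE_iff)
  then have gy: "f x0 \<le> g y" using y(2)[of x0] by (simp add: g_def)
  have "g y \<le> f y" using e by (simp add: g_def sum_nonneg)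
  then have fy: "f y > d" using gy neg by linarith
  have D2g: "partials2 n g (\<lambda>i x. f1 i x - e * (2 * (x i - x0 i))) (\<lambda>i x. f2 i x - e * 2)"
    unfolding g_def
    by (intro partials2_diff[OF D2] partials2_linear[OF _ partials2_sqdist] bounded_linear_mult_right)
  have "f2 i y - e * 2 \<le> 0" if i: "i < n" for i
  proof (rule second_derivative_nonpos_at_local_max)
    show "((\<lambda>s. g (y(i := s))) has_real_derivative (f1 i (y(i := t)) - e * (2 * ((y(i := t)) i - x0 i)))) (at t)" for t
      using partials2D(1)[OF D2g yR i] by (simp add: has_real_derivative_iff_has_vector_derivative)
    show "((\<lambda>t. f1 i (y(i := t)) - e * (2 * ((y(i := t)) i - x0 i))) has_real_derivative f2 i y - e * 2) (at (y i))"
      using partials2D(2)[OF D2g yR i, of "y i"] by (simp add: has_real_derivative_iff_has_vector_derivative)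
    \<comment> \<open>On a face of the cube \<open>g\<close> is at most
      \<open>M - e * R\<^sup>2\<close>, hence below \<open>f x0\<close>, so the maximum is interior
      in every coordinate direction.\<close>
    have "\<bar>y i - x0 i\<bar> < R"
    proof (rule ccontr)
      assume "\<not> \<bar>y i - x0 i\<bar> < R"
      then have "R\<^sup>2 \<le> (y i - x0 i)\<^sup>2" using R
        by (metis abs_le_square_iff abs_of_nonneg linorder_not_less order_trans zero_le_one)
      also have "\<dots> \<le> (\<Sum>k<n. (y k - x0 k)\<^sup>2)"
        using i by (intro member_le_sum) auto
      finally have "e * R\<^sup>2 \<le> e * (\<Sum>k<n. (y k - x0 k)\<^sup>2)" using e by simp
      then have "g y \<le> M - e * R\<^sup>2" using bdd[OF yR] by (simp add: g_def)
      then show False using gy eR by linarith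
    qed
    then show "0 < R - \<bar>y i - x0 i\<bar>" by simp
    show "g (y(i := t)) \<le> g (y(i := y i))" if "\<bar>t - y i\<bar> < R - \<bar>y i - x0 i\<bar>" for t
    proof -
      have "y(i := t) \<in> K" using y(1) that i by (auto simp: K_def PiE_iff extensional_def)
      then show ?thesis using y(2) by simp
    qed
  qed
  then have "(\<Sum>i<n. f2 i y) \<le> (\<Sum>i<n. 2 * e)"
    by (intro sum_mono) (auto simp: mult.commute)
  also have "\<dots> < k" using ek by (simp add: mult_ac)
  finally show False using k(2)[OF yR fy] by simp
qed

section \<open>Line segments\<close>

text \<open>The parameter \<open>p\<close> may be a time, or a pair of a time with a base point, a
  second time or a scale; this one form supplies the joint continuity for all differentiations and
  limits under the integral below.\<close>

lemma continuous_on_line_segment: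
  assumes "continuous_on (Rn n) f" "continuous_on S a"
    "\<And>k. k < n \<Longrightarrow> continuous_on S (\<lambda>p. y p k)"
  shows "continuous_on S (\<lambda>p. f (translate n (\<lambda>k. a p * v k) (y p)))"
proof (rule continuous_on_compose2[OF assms(1)])
  show "continuous_on S (\<lambda>p. translate n (\<lambda>k. a p * v k) (y p))"
    by (intro continuous_on_translate continuous_on_mult_right assms)
qed (simp add: image_subset_iff)

lemma continuous_on_fun_upd_coordinate:
  fixes y :: "nat \<Rightarrow> real"
  assumes "continuous_on S a"
  shows "continuous_on S (\<lambda>p. (y(i := a p)) k)"
  using assms by (cases "k = i") simp_all

text \<open>Induction on the number of coordinates that move; continuity of one of the two partial
  derivatives is enough for joint differentiability in each step.\<close>

lemma has_vector_derivative_along_line: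
  fixes f :: "(nat \<Rightarrow> real) \<Rightarrow> 'b::real_normed_vector"
  assumes D2: "partials2 n f f1 f2" and cont: "\<And>i. i < n \<Longrightarrow> continuous_on (Rn n) (f1 i)"
  shows "((\<lambda>t. f (translate n (\<lambda>k. t * v k) x)) has_vector_derivative
    (\<Sum>i<n. v i *\<^sub>R f1 i (translate n (\<lambda>k. t * v k) x))) (at t)"
proof -
  define p where "p m t x = translate n (\<lambda>k. t * (if k < m then v k else 0)) x" for m t x
  have "((\<lambda>t. f (p m t x)) has_vector_derivative (\<Sum>i<m. v i *\<^sub>R f1 i (p m t x))) (at t)"
    if "m \<le> n" for m x t
    using that
  proof (induction m arbitrary: x t)
    case 0
    then show ?case by (simp add: p_def)
  next
    case (Suc m)
    then have m: "m < n" by simp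
    \<comment> \<open>Moving coordinates up to and including \<open>m\<close> is the same as moving
      those below \<open>m\<close> from the base point \<open>y t\<close>. The two roles of
      \<open>t\<close> are separated into \<open>s\<close> and \<open>r\<close>, the resulting map
      is differentiated at \<open>(t, t)\<close>, and the chain rule along the diagonal finishes the
      step.\<close>
    define y where "y r = x(m := x m + r * v m)" for r
    have pSuc: "p (Suc m) t x = p m t (y t)" for t
      by (auto simp: p_def translate_def y_def fun_eq_iff)
    have py: "p m s (y r) = (p m s x)(m := x m + r * v m)" for s r
      using m by (auto simp: p_def translate_def y_def fun_eq_iff)
    have pR: "p m s z \<in> Rn n" for s z
      unfolding p_def by (rule translate_in_Rn)
    have deriv_r: "((\<lambda>r. f (p m s (y r))) has_vector_derivative v m *\<^sub>R f1 m (p m s (y r))) (at r)" for s r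
    proof -
      have 1: "((\<lambda>r. x m + r * v m) has_vector_derivative v m) (at r)"
        by (auto intro!: derivative_eq_intros)
      show ?thesis
        using vector_diff_chain_at[OF 1 partials2D(1)[OF D2 pR[of s x] m, of "x m + r * v m"]]
        by (simp add: o_def py)
    qed
    have "((\<lambda>(s, r). f (p m s (y r))) has_derivative
       (\<lambda>(a, b). a *\<^sub>R (\<Sum>i<m. v i *\<^sub>R f1 i (p m t (y t))) +
          blinfun_apply (blinfun_scaleR_left (v m *\<^sub>R f1 m (p m t (y t)))) b)) (at (t, t) within UNIV \<times> UNIV)"
    proof (rule has_derivative_partialsI[where
          fy = "\<lambda>s r. blinfun_scaleR_left (v m *\<^sub>R f1 m (p m s (y r)))"])
      show "((\<lambda>s. f (p m s (y t))) has_derivative (\<lambda>a. a *\<^sub>R (\<Sum>i<m. v i *\<^sub>R f1 i (p m t (y t))))) (at t)"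
        using Suc.IH[of "y t" t] m by (simp add: has_vector_derivative_def)
      show "((\<lambda>r. f (p m s (y r))) has_derivative
         blinfun_apply (blinfun_scaleR_left (v m *\<^sub>R f1 m (p m s (y r))))) (at r within UNIV)" for s r
        using deriv_r[of s r] by (simp add: has_vector_derivative_def)
      have "continuous_on UNIV (\<lambda>q. f1 m (p m (fst q) (y (snd q))))"
        unfolding p_def y_def
      proof (rule continuous_on_line_segment[OF cont[OF m]])
        show "continuous_on UNIV (\<lambda>q :: real \<times> real. fst q)"
          by (rule continuous_on_fst[OF continuous_on_id])
        have "continuous_on UNIV (\<lambda>q :: real \<times> real. x m + snd q * v m)"
          by (auto intro!: continuous_intros)
        then show "continuous_on UNIV (\<lambda>q :: real \<times> real. (x(m := x m + snd q * v m)) k)" for k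
          by (rule continuous_on_fun_upd_coordinate)
      qed
      then have "continuous_on UNIV (\<lambda>q. blinfun_scaleR_left (v m *\<^sub>R f1 m (p m (fst q) (y (snd q)))))"
        by (rule bounded_linear.continuous_on[OF bounded_linear_blinfun_scaleR_left
              continuous_on_scaleR[OF continuous_on_const]])
      then show "continuous (at (t, t) within UNIV \<times> UNIV)
         (\<lambda>(s, r). blinfun_scaleR_left (v m *\<^sub>R f1 m (p m s (y r))))"
        unfolding case_prod_beta' UNIV_Times_UNIV
        by (rule continuous_on_imp_continuous_within) auto
    qed auto
    then have D: "((\<lambda>q. f (p m (fst q) (y (snd q)))) has_derivative
       (\<lambda>q. fst q *\<^sub>R (\<Sum>i<m. v i *\<^sub>R f1 i (p m t (y t))) + snd q *\<^sub>R (v m *\<^sub>R f1 m (p m t (y t))))) (at (t, t))"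
      by (simp add: case_prod_beta')
    have "((\<lambda>t. (t, t)) has_derivative (\<lambda>h. (h, h))) (at t)"
      by (intro has_derivative_Pair has_derivative_ident)
    from has_derivative_compose[OF this D] show ?case
      by (simp add: has_vector_derivative_def pSuc scaleR_add_right)
  qed
  from this[of n x t] have
    "((\<lambda>t. f (p n t x)) has_vector_derivative (\<Sum>i<n. v i *\<^sub>R f1 i (p n t x))) (at t)"
    by simp
  moreover have "p n t x = translate n (\<lambda>k. t * v k) x" for t
    by (auto simp: p_def translate_def fun_eq_iff)
  ultimately show ?thesis by simp
qed

definition segment_avg :: "nat \<Rightarrow> (nat \<Rightarrow> real) \<Rightarrow> ((nat \<Rightarrow> real) \<Rightarrow> real) \<Rightarrow> (nat \<Rightarrow> real) \<Rightarrow> real" where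
  "segment_avg n v f x = integral {0..1} (\<lambda>s. f (translate n (\<lambda>k. s * v k) x))"

lemma integrable_on_segment:
  fixes f :: "(nat \<Rightarrow> real) \<Rightarrow> 'b::banach"
  assumes "continuous_on (Rn n) f"
  shows "(\<lambda>s. f (translate n (\<lambda>k. s * v k) x)) integrable_on {0..1}"
  by (rule integrable_continuous_real[OF continuous_on_line_segment[OF assms continuous_on_id continuous_on_const]])

text \<open>Differentiation under the integral sign. Changing \<open>x i\<close> shifts all points
  of the segment equally, so the inner derivative is 1. Stated for one coordinate and one
  derivative, it serves both the passage from \<open>f\<close> to \<open>f1\<close> and that from
  \<open>f1\<close> to \<open>f2\<close>.\<close>

lemma has_vector_derivative_segment_avg:
  assumes d: "\<And>x t. x \<in> Rn n \<Longrightarrow> ((\<lambda>s. f (x(i := s))) has_vector_derivative f' (x(i := t))) (at t)"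
    and f: "continuous_on (Rn n) f" and f': "continuous_on (Rn n) f'" and i: "i < n"
  shows "((\<lambda>t. segment_avg n v f (x(i := t))) has_vector_derivative segment_avg n v f' x) (at (x i))"
proof -
  have "((\<lambda>t. integral (cbox 0 1) (\<lambda>s. f (translate n (\<lambda>k. s * v k) (x(i := t))))) has_vector_derivative
    integral (cbox 0 1) (\<lambda>s. f' (translate n (\<lambda>k. s * v k) (x(i := x i))))) (at (x i) within UNIV)"
  proof (rule leibniz_rule_vector_derivative[where
        fx = "\<lambda>t s. f' (translate n (\<lambda>k. s * v k) (x(i := t)))"])
    show "((\<lambda>t. f (translate n (\<lambda>k. s * v k) (x(i := t)))) has_vector_derivative
       f' (translate n (\<lambda>k. s * v k) (x(i := t)))) (at t within UNIV)" for t s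
    proof -
      have 1: "((\<lambda>t. t + s * v i) has_vector_derivative 1) (at t)"
        by (auto intro!: derivative_eq_intros)
      show ?thesis
        using vector_diff_chain_at[OF 1 d[OF translate_in_Rn[of n "\<lambda>k. s * v k" x]]] i
        by (simp add: o_def translate_fun_upd)
    qed
    show "(\<lambda>s. f (translate n (\<lambda>k. s * v k) (x(i := t)))) integrable_on cbox 0 1" for t
      using integrable_on_segment[OF f] by simp
    show "continuous_on (UNIV \<times> cbox 0 1) (\<lambda>(t, s). f' (translate n (\<lambda>k. s * v k) (x(i := t))))"
      unfolding case_prod_beta'
      by (rule continuous_on_line_segment[OF f' continuous_on_snd[OF continuous_on_id]
            continuous_on_fun_upd_coordinate[OF continuous_on_fst[OF continuous_on_id]]])
  qed auto
  then show ?thesis by (simp add: segment_avg_def)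
qed

lemma partials2_segment_avg:
  assumes D2: "partials2 n f f1 f2" and f: "continuous_on (Rn n) f"
    and f1: "\<And>i. i < n \<Longrightarrow> continuous_on (Rn n) (f1 i)" and f2: "\<And>i. i < n \<Longrightarrow> continuous_on (Rn n) (f2 i)"
  shows "partials2 n (segment_avg n v f) (\<lambda>i. segment_avg n v (f1 i)) (\<lambda>i. segment_avg n v (f2 i))"
  unfolding partials2_def
proof (intro ballI allI impI conjI)
  fix x i assume i: "i < n"
  show "((\<lambda>t. segment_avg n v f (x(i := t))) has_vector_derivative segment_avg n v (f1 i) x) (at (x i))"
    by (rule has_vector_derivative_segment_avg[OF partials2D(1)[OF D2 _ i] f f1[OF i] i])
  show "((\<lambda>t. segment_avg n v (f1 i) (x(i := t))) has_vector_derivative segment_avg n v (f2 i) x) (at (x i))"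
    by (rule has_vector_derivative_segment_avg[OF partials2D(2)[OF D2 _ i] f1[OF i] f2[OF i] i])
qed

lemma continuous_on_segment_avg:
  assumes "continuous_on (Rn n) f"
  shows "continuous_on (Rn n) (segment_avg n v f)"
proof -
  have "continuous_on (Rn n \<times> cbox 0 1) (\<lambda>(x, s). f (translate n (\<lambda>k. s * v k) x))"
    unfolding case_prod_beta'
  proof (rule continuous_on_line_segment[OF assms])
    show "continuous_on (Rn n \<times> cbox 0 1) (\<lambda>p :: (nat \<Rightarrow> real) \<times> real. fst p k)" for k
      by (rule continuous_on_compose2[OF continuous_on_coordinate[of UNIV k] continuous_on_fst[OF continuous_on_id]]) simp
  qed (rule continuous_on_snd[OF continuous_on_id])
  from integral_continuous_on_param[OF this] show ?thesis by (simp add: segment_avg_def[abs_def])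
qed

text \<open>At \<open>h = 0\<close> the segment degenerates to a point, so this continuity turns
  averages into point values when increments shrink.\<close>

lemma continuous_on_segment_avg_scale:
  assumes "continuous_on (Rn n) f"
  shows "continuous_on UNIV (\<lambda>h. segment_avg n (\<lambda>k. h * v k) f x)"
proof -
  have "continuous_on (UNIV \<times> cbox 0 1) (\<lambda>(h, s). f (translate n (\<lambda>k. (s * h) * v k) x))"
    unfolding case_prod_beta'
    by (rule continuous_on_line_segment[OF assms continuous_on_mult[OF
            continuous_on_snd[OF continuous_on_id] continuous_on_fst[OF continuous_on_id]]
          continuous_on_const])
  from integral_continuous_on_param[OF this] show ?thesis by (simp add: segment_avg_def mult.assoc)
qed

section \<open>Essential bounds and the strong maximum principle\<close>

text \<open>By continuity the set where the norm exceeds the essential bound is open; if nonempty,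
  it would contain an open cube, which has positive measure.\<close>

lemma continuous_bounded_if_Linf:
  fixes u :: "(nat \<Rightarrow> real) \<Rightarrow> real ^ 'm"
  assumes cont: "continuous_on (Rn n) u" and u: "Linf n u"
  shows "\<exists>M. \<forall>x\<in>Rn n. norm (u x) \<le> M"
proof -
  obtain M where M: "esssup (lebesgue_Rn n) (\<lambda>x. ereal (norm (u x))) \<le> ereal M"
    using u by (cases "esssup (lebesgue_Rn n) (\<lambda>x. ereal (norm (u x)))") (auto simp: Linf_def)
  have ae: "AE x in lebesgue_Rn n. norm (u x) \<le> M"
    using esssup_AE[of "\<lambda>x. ereal (norm (u x))" "lebesgue_Rn n"]
  proof (rule AE_mp, intro AE_I2 impI)
    fix x assume "ereal (norm (u x)) \<le> esssup (lebesgue_Rn n) (\<lambda>x. ereal (norm (u x)))"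
    from order_trans[OF this M] show "norm (u x) \<le> M" by simp
  qed
  have "norm (u x) \<le> M" if x: "x \<in> Rn n" for x
  proof (rule ccontr)
    assume neg: "\<not> norm (u x) \<le> M"
    define U where "U = {y \<in> Rn n. norm (u y) \<in> {M<..}}"
    have "continuous_map (powertop_real {..<n}) euclideanreal (\<lambda>y. norm (u y))"
      unfolding continuous_on_Rn_iff by (rule continuous_on_norm[OF cont])
    from openin_continuous_map_preimage[OF this, of "{M<..}"]
    have "openin (powertop_real {..<n}) U"
      by (simp add: U_def)
    moreover have "x \<in> U"
      using neg x by (simp add: U_def)
    ultimately obtain r where r: "r > 0" "\<And>y. y \<in> Rn n \<Longrightarrow> (\<And>i. i < n \<Longrightarrow> \<bar>y i - x i\<bar> < r) \<Longrightarrow> y \<in> U"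
      using openin_Rn_box by blast
    define B where "B = PiE {..<n} (\<lambda>i. {x i - r<..<x i + r})"
    interpret product_sigma_finite "\<lambda>_::nat. lborel :: real measure"
      by standard
    have Bset: "B \<in> sets (lebesgue_Rn n)"
      unfolding B_def by (rule sets_PiM_I_finite) auto
    have "emeasure (lebesgue_Rn n) B = (\<Prod>i<n. emeasure lborel {x i - r<..<x i + r})"
      unfolding B_def by (rule emeasure_PiM) auto
    also have "\<dots> = ennreal (\<Prod>i<n. 2 * r)"
      using r(1) by (subst prod_ennreal[symmetric]) auto
    finally have "emeasure (lebesgue_Rn n) B \<noteq> 0"
      using r(1) by (simp add: ennreal_eq_0_iff not_le)
    moreover have "AE y in lebesgue_Rn n. y \<notin> B"
      using ae
    proof (rule AE_mp, intro AE_I2 impI notI)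
      fix y assume y: "norm (u y) \<le> M" "y \<in> B"
      have "y \<in> U"
      proof (rule r(2))
        show "y \<in> Rn n" using y(2) unfolding B_def PiE_iff by simp
        show "\<bar>y i - x i\<bar> < r" if "i < n" for i
          using PiE_mem[OF y(2)[unfolded B_def], of i] that by auto
      qed
      then show False using y(1) by (simp add: U_def)
    qed
    then have "B \<in> null_sets (lebesgue_Rn n)"
      using AE_iff_null_sets[OF Bset] by simp
    ultimately show False by (simp add: null_sets_def)
  qed
  then show ?thesis by (intro exI[of _ M] ballI)
qed

text \<open>Hopf's barrier \<open>exp (- c |x - y|\<^sup>2)\<close>; since \<open>w \<ge> 0\<close> on the whole space, no annulus is needed.\<close>

lemma nonneg_supersolution_pos:
  fixes w :: "(nat \<Rightarrow> real) \<Rightarrow> real"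
  assumes cont: "continuous_on (Rn n) w" and D2: "partials2 n w w1 w2"
    and nonneg: "\<And>x. x \<in> Rn n \<Longrightarrow> w x \<ge> 0"
    and B: "\<And>x. x \<in> Rn n \<Longrightarrow> (\<Sum>i<n. w2 i x) \<le> B * w x"
    and y: "y \<in> Rn n" "w y > 0" and z: "z \<in> Rn n"
  shows "w z > 0"
proof -
  \<comment> \<open>By continuity \<open>w > e\<close> on a cube around \<open>y\<close>, so points
    with \<open>w x \<le> e\<close> keep a distance of at least \<open>r\<close> from
    \<open>y\<close>.\<close>
  define e where "e = w y / 2"
  have e: "e > 0" using y by (simp add: e_def)
  define U where "U = {x \<in> Rn n. w x \<in> {e<..}}"
  have "openin (powertop_real {..<n}) U"
    using openin_continuous_map_preimage[OF cont[folded continuous_on_Rn_iff], of "{e<..}"]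
    by (simp add: U_def)
  moreover have "y \<in> U" using y by (simp add: U_def e_def)
  ultimately obtain r where r: "r > 0" "\<And>x. x \<in> Rn n \<Longrightarrow> (\<And>i. i < n \<Longrightarrow> \<bar>x i - y i\<bar> < r) \<Longrightarrow> x \<in> U"
    using openin_Rn_box by blast
  define q where "q x = (\<Sum>k<n. (x k - y k)\<^sup>2)" for x
  have q0: "q x \<ge> 0" for x by (simp add: q_def sum_nonneg)
  have far: "q x \<ge> r\<^sup>2" if "x \<in> Rn n" "w x \<le> e" for x
  proof -
    have "x \<notin> U" using that by (simp add: U_def)
    have "\<exists>i<n. \<bar>x i - y i\<bar> \<ge> r"
    proof (rule ccontr)
      assume "\<not> ?thesis"
      then have "\<bar>x i - y i\<bar> < r" if "i < n" for i
        using that by (simp add: not_le)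
      from r(2)[OF that(1) this] \<open>x \<notin> U\<close> show False by simp
    qed
    then obtain i where i: "i < n" "\<bar>x i - y i\<bar> \<ge> r"
      by (elim exE conjE)
    have "r\<^sup>2 \<le> (x i - y i)\<^sup>2"
      using i(2) r(1) by (metis abs_le_square_iff abs_of_pos)
    also have "\<dots> \<le> q x" unfolding q_def using i(1) by (intro member_le_sum) auto
    finally show ?thesis .
  qed
  \<comment> \<open>Away from the ball of radius \<open>r\<close> the term
    \<open>4 c\<^sup>2 q h\<close> of the barrier's Laplacian must dominate \<open>2 n c h\<close>
    together with \<open>(\<bar>B\<bar> + 1) h\<close>.\<close>
  define c where "c = (2 * real n + \<bar>B\<bar> + 1) / (4 * r\<^sup>2) + 1"
  have c1: "c \<ge> 1" using r(1) by (simp add: c_def)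
  have c2: "4 * c * r\<^sup>2 \<ge> 2 * n + \<bar>B\<bar> + 1"
  proof -
    have "4 * c * r\<^sup>2 = (2 * n + \<bar>B\<bar> + 1) + 4 * r\<^sup>2"
      using r(1) by (simp add: c_def field_simps)
    then show ?thesis by simp
  qed
  define h where "h x = e * exp (- c * q x)" for x
  define f2 where "f2 i x = c\<^sup>2 * h x * (2 * (x i - y i))\<^sup>2 + (- c * h x) * 2 - w2 i x" for i x
  have D2f: "partials2 n (\<lambda>x. h x - w x) (\<lambda>i x. (- c * h x) * (2 * (x i - y i)) - w1 i x) f2"
    unfolding f2_def h_def q_def
  proof (rule partials2_diff[OF partials2_compose_real[OF partials2_sqdist] D2])
    show "((\<lambda>s. e * exp (- c * s)) has_real_derivative - c * (e * exp (- c * s))) (at s)" for s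
      by (auto intro!: derivative_eq_intros)
    show "((\<lambda>s. - c * (e * exp (- c * s))) has_real_derivative c\<^sup>2 * (e * exp (- c * s))) (at s)" for s
      by (auto intro!: derivative_eq_intros simp: power2_eq_square)
  qed
  have hpos: "h x > 0" for x using e by (simp add: h_def)
  have hle: "h x \<le> e" for x
    using e c1 q0[of x] by (simp add: h_def)
  \<comment> \<open>The threshold \<open>h z / 2\<close> is also the lower bound on the Laplacian:
    where \<open>h - w\<close> exceeds it, \<open>w < h \<le> e\<close>, so the point is far from
    \<open>y\<close> and the Laplacian of \<open>h - w\<close> is at least \<open>h\<close>.\<close>
  have "h z - w z \<le> h z / 2"
  proof (rule bounded_subsolution_le[OF _ D2f _ _ _ z])
    show "continuous_on (Rn n) (\<lambda>x. h x - w x)"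
      unfolding h_def q_def by (intro continuous_intros cont)
    show "h x - w x \<le> e" if "x \<in> Rn n" for x
      using hle[of x] nonneg[OF that] by linarith
    show "h z / 2 > 0" using hpos by simp
    show "h z / 2 \<le> (\<Sum>i<n. f2 i x)" if x: "x \<in> Rn n" "h z / 2 < h x - w x" for x
    proof -
      have wx: "w x < h x" using x(2) hpos[of z] by linarith
      have qr: "q x \<ge> r\<^sup>2" using far[OF x(1)] wx hle[of x] by linarith
      have "f2 i x = 4 * c\<^sup>2 * h x * (x i - y i)\<^sup>2 - 2 * c * h x - w2 i x" for i
        by (simp add: f2_def power2_eq_square algebra_simps)
      then have "(\<Sum>i<n. f2 i x) = 4 * c\<^sup>2 * h x * q x - 2 * n * c * h x - (\<Sum>i<n. w2 i x)"
        by (simp add: q_def sum_subtractf sum_distrib_left)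
      moreover have "(\<Sum>i<n. w2 i x) \<le> \<bar>B\<bar> * h x"
      proof -
        have "B * w x \<le> \<bar>B\<bar> * h x"
          using wx nonneg[OF x(1)] by (intro mult_mono) auto
        then show ?thesis using B[OF x(1)] by linarith
      qed
      moreover have "(2 * n * c + \<bar>B\<bar> + 1) * h x \<le> 4 * c\<^sup>2 * q x * h x"
      proof (rule mult_right_mono)
        have "2 * n * c + \<bar>B\<bar> + 1 \<le> 2 * n * c + \<bar>B\<bar> * c + c"
          using c1 mult_left_mono[OF c1, of "\<bar>B\<bar>"] by simp
        also have "\<dots> = c * (2 * n + \<bar>B\<bar> + 1)" by (simp add: algebra_simps)
        also have "\<dots> \<le> c * (4 * c * r\<^sup>2)"
          using c1 c2 by (intro mult_left_mono) auto
        also have "\<dots> = 4 * c\<^sup>2 * r\<^sup>2" by (simp add: power2_eq_square)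
        also have "\<dots> \<le> 4 * c\<^sup>2 * q x" using qr by (intro mult_left_mono) auto
        finally show "2 * n * c + \<bar>B\<bar> + 1 \<le> 4 * c\<^sup>2 * q x" .
      qed (use hpos[of x] in simp)
      ultimately have "(\<Sum>i<n. f2 i x) \<ge> h x"
        by (simp add: algebra_simps)
      then show ?thesis using x(2) nonneg[OF x(1)] by linarith
    qed
  qed
  then show ?thesis using hpos[of z] by linarith
qed

section \<open>Matrices as bilinear forms\<close>

lemma diag_mult_vec [simp]: "(diag \<nu> *v z) $ j = \<nu> $ j * z $ j"
  by (simp add: diag_def matrix_vector_mult_def if_distrib if_distribR cong: if_cong)

lemma bounded_bilinear_matrix: "bounded_bilinear (\<lambda>v z. (A *v v) \<bullet> z)" for A :: "real ^ 'm ^ 'm"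
  by (rule bounded_bilinear.comp1[OF bounded_bilinear_inner matrix_vector_mul_bounded_linear])

lemma norm_matrix_mult_le: "norm (A *v v) \<le> onorm ((*v) A) * norm v" for A :: "real ^ 'm ^ 'm"
  by (rule onorm) simp

lemma onorm_matrix_nonneg: "0 \<le> onorm ((*v) A)" for A :: "real ^ 'm ^ 'm"
  by (rule onorm_pos_le) simp

lemma abs_matrix_inner_le: "\<bar>(A *v v) \<bullet> z\<bar> \<le> onorm ((*v) A) * norm v * norm z" for A :: "real ^ 'm ^ 'm"
  using Cauchy_Schwarz_ineq2[of "A *v v" z] mult_right_mono[OF norm_matrix_mult_le[of A v] norm_ge_zero[of z]]
  by linarith

lemma continuous_on_matrix_inner:
  fixes A :: "real ^ 'm ^ 'm"
  assumes "continuous_on S f" "continuous_on S g"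
  shows "continuous_on S (\<lambda>x. (A *v f x) \<bullet> g x)"
  by (rule bounded_bilinear.continuous_on[OF bounded_bilinear_matrix assms])

lemma diag_inner_commute: "(diag \<nu> *v v) \<bullet> z = (diag \<nu> *v z) \<bullet> v"
  by (simp add: inner_vec_def mult_ac)

section \<open>Estimates for the system\<close>

text \<open>The hypotheses in the form in which they are used: the inverse of \<open>D\<close> is
  explicit, the system is solved for the Laplacian, the derivatives of \<open>u\<close> are named,
  and the bound on \<open>u\<close> holds pointwise.\<close>

locale competition_system =
  fixes A :: "real ^ 'm ^ 'm" and \<nu> :: "real ^ 'm" and c :: real and n :: nat
    and u :: "(nat \<Rightarrow> real) \<Rightarrow> real ^ 'm" and u1 u2 :: "nat \<Rightarrow> (nat \<Rightarrow> real) \<Rightarrow> real ^ 'm"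
  assumes \<nu>_pos: "\<And>j. \<nu> $ j > 0"
    and sym_nonneg: "\<And>v. (A *v (diag (\<chi> j. 1 / \<nu> $ j) *v v)) \<bullet> v + (A *v v) \<bullet> (diag (\<chi> j. 1 / \<nu> $ j) *v v) \<ge> 0"
    and c_pos: "c > 0" and coercive: "\<And>v. (A *v v) \<bullet> v \<ge> c * (norm v)\<^sup>2"
    and D2: "partials2 n u u1 u2"
    and cont: "continuous_on (Rn n) u"
    and cont1: "\<And>i. i < n \<Longrightarrow> continuous_on (Rn n) (u1 i)"
    and cont2: "\<And>i. i < n \<Longrightarrow> continuous_on (Rn n) (u2 i)"
    and bounded: "\<exists>M. \<forall>x\<in>Rn n. norm (u x) \<le> M"
    and lap_u: "\<And>x. x \<in> Rn n \<Longrightarrow>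
      (\<Sum>i<n. u2 i x) = - ((1 - (A *v u x) \<bullet> u x) *\<^sub>R (diag (\<chi> j. 1 / \<nu> $ j) *v u x))"
begin

abbreviation "D \<equiv> diag \<nu>"
abbreviation "Di \<equiv> diag (\<chi> j. 1 / \<nu> $ j)"
abbreviation "nA \<equiv> onorm ((*v) A)"
abbreviation "nD \<equiv> onorm ((*v) D)"
abbreviation "nDi \<equiv> onorm ((*v) Di)"

definition w :: "(nat \<Rightarrow> real) \<Rightarrow> real" where
  "w x = 1 - (A *v u x) \<bullet> u x"

text \<open>The leading \<open>0 -\<close> comes from differentiating the constant 1, in the literal
  shape produced by \<open>partials2_diff\<close> and \<open>partials2_bilinear\<close>.\<close>

definition w1 :: "nat \<Rightarrow> (nat \<Rightarrow> real) \<Rightarrow> real" where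
  "w1 i x = 0 - ((A *v u x) \<bullet> u1 i x + (A *v u1 i x) \<bullet> u x)"

definition w2 :: "nat \<Rightarrow> (nat \<Rightarrow> real) \<Rightarrow> real" where
  "w2 i x = 0 - ((A *v u x) \<bullet> u2 i x + 2 *\<^sub>R ((A *v u1 i x) \<bullet> u1 i x) + (A *v u2 i x) \<bullet> u x)"

text \<open>The zeroth-order coefficient in the equation for \<open>w\<close>; it is the quadratic
  form of hypothesis (i) at \<open>u x\<close>.\<close>

definition b :: "(nat \<Rightarrow> real) \<Rightarrow> real" where
  "b x = (A *v (Di *v u x)) \<bullet> u x + (A *v u x) \<bullet> (Di *v u x)"

lemma \<nu>_nonzero: "\<nu> $ j \<noteq> 0" and \<nu>_nonneg: "\<nu> $ j \<ge> 0"
  using \<nu>_pos[of j] by simp_all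

lemma D_inner_Di: "(D *v v) \<bullet> (Di *v z) = v \<bullet> z"
  by (simp add: inner_vec_def \<nu>_nonzero)

lemma D_inner_self: "(D *v v) \<bullet> v = (\<Sum>j\<in>UNIV. \<nu> $ j * (v $ j)\<^sup>2)"
  by (simp add: inner_vec_def power2_eq_square mult.assoc)

lemma D_pos: "(D *v v) \<bullet> v \<ge> 0"
  unfolding D_inner_self by (intro sum_nonneg mult_nonneg_nonneg \<nu>_nonneg zero_le_power2)

lemma D_component_le: "\<nu> $ j * (v $ j)\<^sup>2 \<le> (D *v v) \<bullet> v"
  unfolding D_inner_self
  by (rule member_le_sum) (auto intro: mult_nonneg_nonneg \<nu>_nonneg)

lemma eq_0_if_D_nonpos:
  assumes "(D *v v) \<bullet> v \<le> 0"
  shows "v = 0"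
proof -
  have "v $ j = 0" for j
  proof -
    have "\<nu> $ j * (v $ j)\<^sup>2 \<le> 0"
      using D_component_le[of j v] assms by linarith
    then show ?thesis using \<nu>_pos[of j] by (simp add: mult_le_0_iff)
  qed
  then show ?thesis by (simp add: vec_eq_iff)
qed

lemma D_le: "(D *v v) \<bullet> v \<le> nD * (norm v)\<^sup>2"
  using abs_matrix_inner_le[of D v v] by (simp add: power2_eq_square mult.assoc)

lemma A_le: "(A *v v) \<bullet> v \<le> nA * (norm v)\<^sup>2"
  using abs_matrix_inner_le[of A v v] by (simp add: power2_eq_square mult.assoc)

lemma A_pos: "(A *v v) \<bullet> v \<ge> 0"
proof -
  have "0 \<le> c * (norm v)\<^sup>2" using c_pos by simp
  also have "\<dots> \<le> (A *v v) \<bullet> v" by (rule coercive)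
  finally show ?thesis .
qed

lemma D2_w: "partials2 n w w1 w2"
  unfolding w_def[abs_def] w1_def[abs_def] w2_def[abs_def]
  by (rule partials2_diff[OF partials2_const partials2_bilinear[OF bounded_bilinear_matrix D2 D2]])

lemma cont_w: "continuous_on (Rn n) w"
  unfolding w_def[abs_def]
  by (rule continuous_on_diff[OF continuous_on_const continuous_on_matrix_inner[OF cont cont]])

lemma cont_w1: "i < n \<Longrightarrow> continuous_on (Rn n) (w1 i)"
  unfolding w1_def[abs_def]
  by (rule continuous_on_diff[OF continuous_on_const continuous_on_add[OF
          continuous_on_matrix_inner[OF cont cont1] continuous_on_matrix_inner[OF cont1 cont]]])

lemma cont_w2: "i < n \<Longrightarrow> continuous_on (Rn n) (w2 i)"
  unfolding w2_def[abs_def]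
  by (rule continuous_on_diff[OF continuous_on_const continuous_on_add[OF continuous_on_add[OF
          continuous_on_matrix_inner[OF cont cont2] continuous_on_scaleR[OF continuous_on_const
          continuous_on_matrix_inner[OF cont1 cont1]]] continuous_on_matrix_inner[OF cont2 cont]]])

lemma sum_lap_bilinear:
  "(\<Sum>i<n. (B *v f) \<bullet> g i) = (B *v f) \<bullet> (\<Sum>i<n. g i)"
  "(\<Sum>i<n. (B *v g i) \<bullet> f) = (B *v (\<Sum>i<n. g i)) \<bullet> f" for B :: "real ^ 'm ^ 'm"
  by (simp_all add: inner_sum_right inner_sum_left vec.sum)

text \<open>The equation turns both terms containing the Laplacian of \<open>u\<close> into
  multiples of \<open>w\<close>, whose coefficients add up to \<open>b\<close>; only the gradient
  term remains.\<close>

lemma lap_w: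
  assumes "x \<in> Rn n"
  shows "(\<Sum>i<n. w2 i x) = b x * w x - 2 * (\<Sum>i<n. (A *v u1 i x) \<bullet> u1 i x)"
proof -
  have "(\<Sum>i<n. w2 i x) = - ((A *v u x) \<bullet> (\<Sum>i<n. u2 i x)) - 2 * (\<Sum>i<n. (A *v u1 i x) \<bullet> u1 i x)
    - (A *v (\<Sum>i<n. u2 i x)) \<bullet> u x"
    by (simp add: w2_def sum_subtractf sum.distrib sum_negf sum_distrib_left flip: sum_lap_bilinear)
  also have "\<dots> = b x * w x - 2 * (\<Sum>i<n. (A *v u1 i x) \<bullet> u1 i x)"
    unfolding lap_u[OF assms]
    by (simp add: b_def w_def[symmetric] matrix_vector_mult_scaleR vec.neg algebra_simps)
  finally show ?thesis .
qed

lemma b_nonneg: "b x \<ge> 0"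
  unfolding b_def by (rule sym_nonneg)

lemma lap_w_le:
  assumes "x \<in> Rn n"
  shows "(\<Sum>i<n. w2 i x) \<le> b x * w x - 2 * c * (\<Sum>i<n. (norm (u1 i x))\<^sup>2)"
proof -
  have "c * (\<Sum>i<n. (norm (u1 i x))\<^sup>2) \<le> (\<Sum>i<n. (A *v u1 i x) \<bullet> u1 i x)"
    unfolding sum_distrib_left by (intro sum_mono coercive)
  then show ?thesis using lap_w[OF assms] by simp
qed

text \<open>Symmetry of \<open>D\<close> merges the two second-order terms, and positivity of
  \<open>D\<close> lets the gradient term be dropped. The weight \<open>D\<close> is chosen to
  cancel the inverse of \<open>D\<close> in the equation for the Laplacian.\<close>

lemma partials2_energy:
  fixes f :: "(nat \<Rightarrow> real) \<Rightarrow> real ^ 'm"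
  assumes "partials2 n f f1 f2"
  obtains g1 g2 where "partials2 n (\<lambda>x. (D *v f x) \<bullet> f x / 2) g1 g2"
    "\<And>x. (D *v f x) \<bullet> (\<Sum>i<n. f2 i x) \<le> (\<Sum>i<n. g2 i x)"
proof -
  have "partials2 n (\<lambda>x. (D *v f x) \<bullet> f x / 2)
    (\<lambda>i x. ((D *v f x) \<bullet> f1 i x + (D *v f1 i x) \<bullet> f x) / 2)
    (\<lambda>i x. ((D *v f x) \<bullet> f2 i x + 2 *\<^sub>R ((D *v f1 i x) \<bullet> f1 i x) + (D *v f2 i x) \<bullet> f x) / 2)"
    by (rule partials2_linear[OF bounded_linear_divide partials2_bilinear[OF bounded_bilinear_matrix assms assms]])
  moreover have "(D *v f x) \<bullet> (\<Sum>i<n. f2 i x) \<le>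
    (\<Sum>i<n. ((D *v f x) \<bullet> f2 i x + 2 *\<^sub>R ((D *v f1 i x) \<bullet> f1 i x) + (D *v f2 i x) \<bullet> f x) / 2)" for x
  proof -
    have "(D *v f x) \<bullet> f2 i x \<le>
      ((D *v f x) \<bullet> f2 i x + 2 *\<^sub>R ((D *v f1 i x) \<bullet> f1 i x) + (D *v f2 i x) \<bullet> f x) / 2" for i
      using D_pos[of "f1 i x"] diag_inner_commute[of \<nu> "f2 i x" "f x"] by simp
    then show ?thesis unfolding sum_lap_bilinear(1)[symmetric] by (intro sum_mono)
  qed
  ultimately show ?thesis by (rule that)
qed

section \<open>Nonnegativity of \<open>w\<close> and the resulting bounds\<close>

text \<open>Where \<open>w < 0\<close>, both terms of \<open>lap_w_le\<close> make \<open>w\<close>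
  superharmonic, but not strictly. A small multiple of the energy \<open>g\<close> adds strictness,
  because its Laplacian is at least \<open>- w |u|\<^sup>2\<close>.\<close>

lemma w_nonneg:
  assumes x0: "x0 \<in> Rn n"
  shows "w x0 \<ge> 0"
proof (rule ccontr)
  assume neg: "\<not> w x0 \<ge> 0"
  define d where "d = - w x0"
  have d: "d > 0" using neg by (simp add: d_def)
  obtain M where M: "\<And>x. x \<in> Rn n \<Longrightarrow> norm (u x) \<le> M" using bounded by blast
  define G where "G = nD * M\<^sup>2"
  have uM: "(norm (u x))\<^sup>2 \<le> M\<^sup>2" if "x \<in> Rn n" for x
    using M[OF that] by (simp add: power_mono)
  have nD: "nD \<ge> 0" and nA: "nA \<ge> 0" by (rule onorm_matrix_nonneg)+
  have G: "G \<ge> 0" using nD by (simp add: G_def)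
  define g where "g x = (D *v u x) \<bullet> u x / 2" for x
  have g0: "g x \<ge> 0" for x using D_pos[of "u x"] by (simp add: g_def)
  have gG: "g x \<le> G" if "x \<in> Rn n" for x
    using D_le[of "u x"] D_pos[of "u x"] mult_left_mono[OF uM[OF that] nD] by (simp add: g_def G_def)
  obtain g1 g2 where g: "partials2 n g g1 g2" "\<And>x. (D *v u x) \<bullet> (\<Sum>i<n. u2 i x) \<le> (\<Sum>i<n. g2 i x)"
    unfolding g_def using partials2_energy[OF D2] by blast
  \<comment> \<open>Small enough that \<open>e * g\<close> stays below \<open>d / 4\<close>, so that
    \<open>e * g - w > d / 2\<close> forces \<open>- w \<ge> d / 4\<close>.\<close>
  define e where "e = d / (4 * (G + 1))"
  have e: "e > 0" using d G by (simp add: e_def)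
  have eG: "e * G \<le> d / 4" using d G by (simp add: e_def field_simps)
  have "e * g x0 - w x0 \<le> d / 2"
  proof (rule bounded_subsolution_le[OF _ _ _ _ _ x0])
    show "continuous_on (Rn n) (\<lambda>x. e * g x - w x)"
      unfolding g_def by (intro continuous_intros continuous_on_matrix_inner cont cont_w) simp
    show "partials2 n (\<lambda>x. e * g x - w x) (\<lambda>i x. e * g1 i x - w1 i x) (\<lambda>i x. e * g2 i x - w2 i x)"
      by (rule partials2_diff[OF partials2_linear[OF bounded_linear_mult_right g(1)] D2_w])
    show "e * g x - w x \<le> e * G + nA * M\<^sup>2" if x: "x \<in> Rn n" for x
      using A_le[of "u x"] mult_left_mono[OF uM[OF x] nA] mult_left_mono[OF gG[OF x] less_imp_le[OF e]]
      by (simp add: w_def)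
    show "e * (d / 4) / (nA + 1) > 0" using e d nA by simp
    show "e * (d / 4) / (nA + 1) \<le> (\<Sum>i<n. e * g2 i x - w2 i x)"
      if x: "x \<in> Rn n" "d / 2 < e * g x - w x" for x
    proof -
      have wx: "- w x \<ge> d / 4"
        using x(2) eG mult_left_mono[OF gG[OF x(1)], of e] e by linarith
      \<comment> \<open>Negative \<open>w\<close> means that the quadratic form of \<open>A\<close>
        at \<open>u x\<close> exceeds 1, which keeps \<open>u x\<close> away from 0. Passing to
        \<open>nA + 1\<close> makes the later division safe.\<close>
      have "1 \<le> nA * (norm (u x))\<^sup>2"
        using wx d A_le[of "u x"] by (simp add: w_def)
      then have "1 \<le> (nA + 1) * (norm (u x))\<^sup>2"
        unfolding distrib_right using zero_le_power2[of "norm (u x)"] by linarith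
      then have ux: "1 / (nA + 1) \<le> (norm (u x))\<^sup>2"
        using nA by (simp add: field_simps)
      have "(D *v u x) \<bullet> (\<Sum>i<n. u2 i x) = - w x * (norm (u x))\<^sup>2"
        by (simp add: lap_u[OF x(1)] D_inner_Di w_def power2_norm_eq_inner algebra_simps)
      then have "- w x * (norm (u x))\<^sup>2 \<le> (\<Sum>i<n. g2 i x)"
        using g(2)[of x] by simp
      moreover have "(d / 4) * (1 / (nA + 1)) \<le> - w x * (norm (u x))\<^sup>2"
        using wx ux d nA by (intro mult_mono) auto
      ultimately have "e * ((d / 4) * (1 / (nA + 1))) \<le> e * (\<Sum>i<n. g2 i x)"
        using e by (intro mult_left_mono) auto
      moreover have "(\<Sum>i<n. w2 i x) \<le> 0"
      proof -
        have "b x * w x \<le> 0" using b_nonneg[of x] wx d by (simp add: mult_nonneg_nonpos)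
        moreover have "0 \<le> 2 * c * (\<Sum>i<n. (norm (u1 i x))\<^sup>2)"
          using c_pos by (simp add: sum_nonneg)
        ultimately show ?thesis using lap_w_le[OF x(1)] by linarith
      qed
      ultimately show ?thesis by (simp add: sum_subtractf sum_distrib_left)
    qed
  qed
  moreover have "e * g x0 \<ge> 0" using e g0[of x0] by simp
  ultimately show False using d by (simp add: d_def)
qed

lemma w_le_1: "w x \<le> 1"
  using A_pos[of "u x"] by (simp add: w_def)

text \<open>The bound on \<open>|u|\<close> forced by \<open>w \<ge> 0\<close> and coercivity. It
  depends on \<open>c\<close> alone and replaces the assumed bound in all later constants.\<close>

definition U :: real where "U = sqrt (1 / c)"

lemma U_nonneg: "U \<ge> 0"
  using c_pos by (simp add: U_def)

lemma U_sq: "U * U = 1 / c"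
  using c_pos by (simp add: U_def)

lemma norm_u_le:
  assumes "x \<in> Rn n"
  shows "norm (u x) \<le> U"
proof -
  have "c * (norm (u x))\<^sup>2 \<le> 1"
    using coercive[of "u x"] w_nonneg[OF assms] by (simp add: w_def)
  then have "(norm (u x))\<^sup>2 \<le> 1 / c"
    using c_pos by (simp add: field_simps)
  then show ?thesis
    unfolding U_def by (rule real_le_rsqrt)
qed

lemma b_le:
  assumes "x \<in> Rn n"
  shows "b x \<le> 2 * nA * nDi / c"
proof -
  have nA: "nA \<ge> 0" and nDi: "nDi \<ge> 0" by (rule onorm_matrix_nonneg)+
  have ux: "norm (u x) \<le> U" by (rule norm_u_le[OF assms])
  have Dix: "norm (Di *v u x) \<le> nDi * U"
    by (rule order_trans[OF norm_matrix_mult_le mult_left_mono[OF ux nDi]])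
  have "(A *v (Di *v u x)) \<bullet> u x \<le> nA * (nDi * U) * U"
    by (rule order_trans[OF order_trans[OF abs_ge_self abs_matrix_inner_le]])
      (intro mult_mono Dix ux nA nDi mult_nonneg_nonneg U_nonneg order_refl norm_ge_zero)
  moreover have "(A *v u x) \<bullet> (Di *v u x) \<le> nA * U * (nDi * U)"
    by (rule order_trans[OF order_trans[OF abs_ge_self abs_matrix_inner_le]])
      (intro mult_mono Dix ux nA nDi mult_nonneg_nonneg U_nonneg order_refl norm_ge_zero)
  ultimately have "b x \<le> 2 * nA * nDi * (U * U)"
    by (simp add: b_def mult_ac)
  then show ?thesis by (simp add: U_sq)
qed

section \<open>Estimates for increments\<close>

text \<open>The weight \<open>D\<close> reduces the left side to a difference of the nonlinearity
  \<open>w u\<close>. With \<open>d\<close> the increment, this is \<open>- w y |d|\<^sup>2\<close>,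
  controlled by \<open>w \<le> 1\<close>, plus \<open>(w x - w y) (d \<bullet> u x)\<close>, which
  is quadratic in \<open>d\<close> because \<open>w\<close> is Lipschitz in \<open>u\<close> on the
  ball of radius \<open>U\<close>.\<close>

lemma energy_laplacian_ge:
  assumes x: "x \<in> Rn n" and y: "y \<in> Rn n"
  shows "(D *v (u y - u x)) \<bullet> ((\<Sum>i<n. u2 i y) - (\<Sum>i<n. u2 i x)) \<ge> - (1 + 2 * nA / c) * (norm (u y - u x))\<^sup>2"
proof -
  define d where "d = u y - u x"
  have uy: "u y = u x + d" by (simp add: d_def)
  have nA: "nA \<ge> 0" by (rule onorm_matrix_nonneg)
  have ux_le: "norm (u x) \<le> U" and uy_le: "norm (u y) \<le> U"
    using norm_u_le x y by auto
  have "(D *v d) \<bullet> ((\<Sum>i<n. u2 i y) - (\<Sum>i<n. u2 i x)) = w x * (d \<bullet> u x) - w y * (d \<bullet> u y)"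
    using lap_u[OF x] lap_u[OF y] by (simp add: inner_diff_right D_inner_Di w_def)
  also have "\<dots> = - (w y * (d \<bullet> d)) + (w x - w y) * (d \<bullet> u x)"
    by (simp add: uy inner_add_right algebra_simps)
  finally have eq: "(D *v d) \<bullet> ((\<Sum>i<n. u2 i y) - (\<Sum>i<n. u2 i x)) =
    - (w y * (d \<bullet> d)) + (w x - w y) * (d \<bullet> u x)" .
  have 1: "w y * (d \<bullet> d) \<le> 1 * (norm d)\<^sup>2"
    unfolding power2_norm_eq_inner by (intro mult_right_mono w_le_1) simp
  have "w x - w y = (A *v u y) \<bullet> d + (A *v d) \<bullet> u x"
    by (simp add: w_def uy matrix_vector_right_distrib inner_add_left inner_add_right)
  also have "\<bar>\<dots>\<bar> \<le> \<bar>(A *v u y) \<bullet> d\<bar> + \<bar>(A *v d) \<bullet> u x\<bar>"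
    by (rule abs_triangle_ineq)
  also have "\<dots> \<le> nA * U * norm d + nA * norm d * U"
    by (intro add_mono order_trans[OF abs_matrix_inner_le] mult_mono ux_le uy_le nA
        mult_nonneg_nonneg U_nonneg order_refl norm_ge_zero)
  finally have dw: "\<bar>w x - w y\<bar> \<le> 2 * nA * U * norm d"
    by (simp add: mult_ac)
  have "\<bar>d \<bullet> u x\<bar> \<le> norm d * U"
    by (rule order_trans[OF Cauchy_Schwarz_ineq2 mult_left_mono[OF ux_le norm_ge_zero]])
  then have "\<bar>(w x - w y) * (d \<bullet> u x)\<bar> \<le> (2 * nA * U * norm d) * (norm d * U)"
    unfolding abs_mult by (intro mult_mono dw) (auto intro!: mult_nonneg_nonneg nA U_nonneg)
  also have "\<dots> = 2 * nA * (U * U) * (norm d)\<^sup>2"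
    by (simp add: power2_eq_square mult_ac)
  finally have "\<bar>(w x - w y) * (d \<bullet> u x)\<bar> \<le> 2 * nA / c * (norm d)\<^sup>2"
    by (simp add: U_sq)
  then have "(D *v d) \<bullet> ((\<Sum>i<n. u2 i y) - (\<Sum>i<n. u2 i x)) \<ge> - (norm d)\<^sup>2 - 2 * nA / c * (norm d)\<^sup>2"
    unfolding eq using 1 by linarith
  then show ?thesis by (simp add: d_def algebra_simps)
qed

text \<open>Jensen's inequality for \<open>|\<integral>\<phi>|\<^sup>2\<close>, obtained by integrating \<open>2 \<langle>\<phi>, d\<rangle> - |d|\<^sup>2 \<le> |\<phi>|\<^sup>2\<close> with \<open>d = \<integral>\<phi>\<close>.\<close>

lemma norm_increment_le:
  assumes x: "x \<in> Rn n"
  shows "(norm (u (translate n v x) - u x))\<^sup>2 \<le>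
    (\<Sum>k<n. (v k)\<^sup>2) * segment_avg n v (\<lambda>y. \<Sum>i<n. (norm (u1 i y))\<^sup>2) x"
proof -
  define d where "d = u (translate n v x) - u x"
  define p where "p s = translate n (\<lambda>k. s * v k) x" for s
  define \<phi> where "\<phi> s = (\<Sum>i<n. v i *\<^sub>R u1 i (p s))" for s
  have pR: "p s \<in> Rn n" for s by (simp add: p_def)
  have p0: "p 0 = x" using x by (auto simp: p_def translate_def fun_eq_iff PiE_iff extensional_def)
  have p1: "p 1 = translate n v x" by (simp add: p_def)
  \<comment> \<open>The primitive \<open>2 (u (p s) \<bullet> d) - s |d|\<^sup>2\<close> grows over
    the unit interval by exactly \<open>2 |d|\<^sup>2 - |d|\<^sup>2\<close>.\<close>
  have "((\<lambda>s. 2 * (\<phi> s \<bullet> d) - (norm d)\<^sup>2) has_integral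
      (2 * (u (p 1) \<bullet> d) - 1 * (norm d)\<^sup>2) - (2 * (u (p 0) \<bullet> d) - 0 * (norm d)\<^sup>2)) {0..1}"
  proof (rule fundamental_theorem_of_calculus)
    fix s :: real
    have "((\<lambda>s. u (p s)) has_vector_derivative \<phi> s) (at s)"
      unfolding p_def \<phi>_def by (rule has_vector_derivative_along_line[OF D2 cont1])
    from bounded_linear.has_vector_derivative[OF bounded_linear_inner_left[of d] this]
    have "((\<lambda>s. u (p s) \<bullet> d) has_real_derivative \<phi> s \<bullet> d) (at s)"
      by (simp add: has_real_derivative_iff_has_vector_derivative)
    then have "((\<lambda>s. 2 * (u (p s) \<bullet> d) - s * (norm d)\<^sup>2) has_real_derivative 2 * (\<phi> s \<bullet> d) - (norm d)\<^sup>2) (at s)"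
      by (auto intro!: derivative_eq_intros)
    then show "((\<lambda>s. 2 * (u (p s) \<bullet> d) - s * (norm d)\<^sup>2) has_vector_derivative 2 * (\<phi> s \<bullet> d) - (norm d)\<^sup>2) (at s within {0..1})"
      by (simp add: has_real_derivative_iff_has_vector_derivative has_vector_derivative_at_within)
  qed simp
  moreover have "(2 * (u (p 1) \<bullet> d) - 1 * (norm d)\<^sup>2) - (2 * (u (p 0) \<bullet> d) - 0 * (norm d)\<^sup>2) = (norm d)\<^sup>2"
    unfolding p0 p1 power2_norm_eq_inner by (simp add: d_def inner_diff_left)
  ultimately have int1: "((\<lambda>s. 2 * (\<phi> s \<bullet> d) - (norm d)\<^sup>2) has_integral (norm d)\<^sup>2) {0..1}"
    by (simp only:)
  have "continuous_on (Rn n) (\<lambda>y. \<Sum>i<n. (norm (u1 i y))\<^sup>2)"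
    by (intro continuous_on_sum continuous_on_power continuous_on_norm cont1) simp
  from integrable_on_segment[OF this, of v x]
  have int2: "((\<lambda>s. (\<Sum>k<n. (v k)\<^sup>2) * (\<Sum>i<n. (norm (u1 i (p s)))\<^sup>2)) has_integral
     (\<Sum>k<n. (v k)\<^sup>2) * segment_avg n v (\<lambda>y. \<Sum>i<n. (norm (u1 i y))\<^sup>2) x) {0..1}"
    unfolding segment_avg_def p_def by (intro has_integral_mult_right integrable_integral)
  have "2 * (\<phi> s \<bullet> d) - (norm d)\<^sup>2 \<le> (\<Sum>k<n. (v k)\<^sup>2) * (\<Sum>i<n. (norm (u1 i (p s)))\<^sup>2)" for s
  proof -
    have "0 \<le> (norm (\<phi> s - d))\<^sup>2" by simp
    then have "2 * (\<phi> s \<bullet> d) - (norm d)\<^sup>2 \<le> (norm (\<phi> s))\<^sup>2"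
      by (simp add: power2_norm_eq_inner inner_diff_left inner_diff_right inner_commute)
    also have "\<dots> \<le> (\<Sum>i<n. \<bar>v i\<bar> * norm (u1 i (p s)))\<^sup>2"
      unfolding \<phi>_def by (intro power_mono order_trans[OF norm_sum]) simp_all
    also have "\<dots> \<le> (\<Sum>k<n. \<bar>v k\<bar>\<^sup>2) * (\<Sum>i<n. (norm (u1 i (p s)))\<^sup>2)"
      by (rule Cauchy_Schwarz_ineq_sum)
    finally show ?thesis by simp
  qed
  then show ?thesis
    unfolding d_def[symmetric] by (rule has_integral_le[OF int1 int2])
qed

lemma segment_avg_w_nonneg: "segment_avg n v w x \<ge> 0"
  unfolding segment_avg_def by (rule integral_nonneg[OF integrable_on_segment[OF cont_w] w_nonneg]) simp

lemma sum_segment_avg_w2_le: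
  "(\<Sum>i<n. segment_avg n v (w2 i) x) \<le>
    2 * nA * nDi / c * segment_avg n v w x - 2 * c * segment_avg n v (\<lambda>y. \<Sum>i<n. (norm (u1 i y))\<^sup>2) x"
proof -
  let ?p = "\<lambda>s. translate n (\<lambda>k. s * v k) x"
  have "continuous_on (Rn n) (\<lambda>y. \<Sum>i<n. (norm (u1 i y))\<^sup>2)"
    by (intro continuous_on_sum continuous_on_power continuous_on_norm cont1) simp
  note int = integrable_integral[OF integrable_on_segment[OF this, of v x]]
  have int1: "((\<lambda>s. 2 * nA * nDi / c * w (?p s) - 2 * c * (\<Sum>i<n. (norm (u1 i (?p s)))\<^sup>2)) has_integral
    2 * nA * nDi / c * segment_avg n v w x - 2 * c * segment_avg n v (\<lambda>y. \<Sum>i<n. (norm (u1 i y))\<^sup>2) x) {0..1}"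
    unfolding segment_avg_def
    by (rule has_integral_diff[OF has_integral_mult_right[OF integrable_integral[OF
              integrable_on_segment[OF cont_w]]] has_integral_mult_right[OF int]])
  have int2: "((\<lambda>s. \<Sum>i<n. w2 i (?p s)) has_integral (\<Sum>i<n. segment_avg n v (w2 i) x)) {0..1}"
    unfolding segment_avg_def
    by (rule has_integral_sum[OF _ integrable_integral[OF integrable_on_segment[OF cont_w2]]]) auto
  \<comment> \<open>The average of \<open>b w\<close> is not a product of averages, so
    \<open>b\<close> is replaced by its constant upper bound before integrating; this is legitimate
    since \<open>w \<ge> 0\<close>.\<close>
  have "(\<Sum>i<n. w2 i (?p s)) \<le> 2 * nA * nDi / c * w (?p s) - 2 * c * (\<Sum>i<n. (norm (u1 i (?p s)))\<^sup>2)" for s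
    using lap_w_le[OF translate_in_Rn] mult_right_mono[OF b_le[OF translate_in_Rn] w_nonneg[OF translate_in_Rn]]
    by (meson diff_right_mono order_trans)
  then show ?thesis
    by (rule has_integral_le[OF int2 int1])
qed

text \<open>Chosen so that \<open>2 c C - K - B nD / 2 = 1\<close>, where \<open>K = 1 + 2 nA / c\<close> is the constant of
  \<open>energy_laplacian_ge\<close> and \<open>B = 2 nA nDi / c\<close> bounds \<open>b\<close>.\<close>

definition C :: real where
  "C = (2 + 2 * nA / c + nA * nDi * nD / c) / (2 * c)"

lemma C_pos: "C > 0"
proof -
  have "nA * nDi * nD / c \<ge> 0" "2 * nA / c \<ge> 0"
    using c_pos onorm_matrix_nonneg[of A] onorm_matrix_nonneg[of D] onorm_matrix_nonneg[of Di] by simp_all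
  then show ?thesis unfolding C_def using c_pos by (intro divide_pos_pos) linarith+
qed

text \<open>The maximum principle with every threshold \<open>\<delta> > 0\<close>. Where the
  comparison function exceeds \<open>\<delta>\<close>, the averaged gradient term absorbs all
  unfavourable multiples of \<open>|d|\<^sup>2\<close>, and \<open>|d|\<^sup>2\<close> itself is
  bounded below in terms of \<open>\<delta>\<close>, which supplies the strict positivity.\<close>

lemma increment_le:
  assumes x0: "x0 \<in> Rn n"
  shows "(D *v (u (translate n v x0) - u x0)) \<bullet> (u (translate n v x0) - u x0) / 2 \<le>
    C * (\<Sum>k<n. (v k)\<^sup>2) * segment_avg n v w x0"
proof -
  define V where "V = (\<Sum>k<n. (v k)\<^sup>2)"
  define d where "d x = u (translate n v x) - u x" for x
  define e where "e x = (D *v d x) \<bullet> d x / 2" for x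
  have nD: "nD \<ge> 0" by (rule onorm_matrix_nonneg)
  have V: "V \<ge> 0" by (simp add: V_def sum_nonneg)
  have D2d: "partials2 n d (\<lambda>i x. u1 i (translate n v x) - u1 i x) (\<lambda>i x. u2 i (translate n v x) - u2 i x)"
    unfolding d_def[abs_def] by (rule partials2_diff[OF partials2_translate[OF D2] D2])
  obtain e1 e2 where e: "partials2 n e e1 e2"
    "\<And>x. (D *v d x) \<bullet> (\<Sum>i<n. u2 i (translate n v x) - u2 i x) \<le> (\<Sum>i<n. e2 i x)"
    unfolding e_def[abs_def] using partials2_energy[OF D2d] by blast
  have e_le: "e x \<le> nD / 2 * (norm (d x))\<^sup>2" for x
    using D_le[of "d x"] by (simp add: e_def)
  have "e x0 - C * V * segment_avg n v w x0 \<le> \<delta>" if \<delta>: "\<delta> > 0" for \<delta>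
  proof (rule bounded_subsolution_le[OF _ _ _ _ _ x0])
    have "continuous_on (Rn n) d"
      unfolding d_def[abs_def]
    proof (rule continuous_on_diff[OF continuous_on_compose2[OF cont] cont])
      show "continuous_on (Rn n) (translate n v)"
        by (rule continuous_on_translate[OF continuous_on_const continuous_on_coordinate])
    qed (simp add: image_subset_iff)
    then have "continuous_on (Rn n) e"
      unfolding e_def[abs_def] by (intro continuous_intros continuous_on_matrix_inner) simp_all
    then show "continuous_on (Rn n) (\<lambda>x. e x - C * V * segment_avg n v w x)"
      by (rule continuous_on_diff[OF _ continuous_on_mult[OF continuous_on_const continuous_on_segment_avg[OF cont_w]]])
    show "partials2 n (\<lambda>x. e x - C * V * segment_avg n v w x)
      (\<lambda>i x. e1 i x - C * V * segment_avg n v (w1 i) x) (\<lambda>i x. e2 i x - C * V * segment_avg n v (w2 i) x)"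
      by (rule partials2_diff[OF e(1) partials2_linear[OF bounded_linear_mult_right
              partials2_segment_avg[OF D2_w cont_w cont_w1 cont_w2]]])
    show "e x - C * V * segment_avg n v w x \<le> nD / 2 * (2 * U)\<^sup>2" if "x \<in> Rn n" for x
    proof -
      have "norm (d x) \<le> 2 * U"
        unfolding d_def
        using norm_triangle_ineq4[of "u (translate n v x)" "u x"] norm_u_le[OF that]
          norm_u_le[OF translate_in_Rn[of n v x]] by linarith
      then have "(norm (d x))\<^sup>2 \<le> (2 * U)\<^sup>2"
        by (intro power_mono) simp_all
      then have "nD / 2 * (norm (d x))\<^sup>2 \<le> nD / 2 * (2 * U)\<^sup>2"
        using nD by (intro mult_left_mono) simp_all
      moreover have "C * V * segment_avg n v w x \<ge> 0"
        using C_pos V segment_avg_w_nonneg by simp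
      ultimately show ?thesis using e_le[of x] by linarith
    qed
    show "2 * \<delta> / (nD + 1) > 0" using \<delta> nD by simp
    show "2 * \<delta> / (nD + 1) \<le> (\<Sum>i<n. e2 i x - C * V * segment_avg n v (w2 i) x)"
      if x: "x \<in> Rn n" "\<delta> < e x - C * V * segment_avg n v w x" for x
    proof -
      define N where "N = (norm (d x))\<^sup>2"
      define W where "W = segment_avg n v w x"
      define S where "S = segment_avg n v (\<lambda>y. \<Sum>i<n. (norm (u1 i y))\<^sup>2) x"
      define B where "B = 2 * nA * nDi / c"
      have B: "B \<ge> 0"
        using c_pos onorm_matrix_nonneg[of A] onorm_matrix_nonneg[of Di] by (simp add: B_def)
      have NS: "N \<le> V * S"
        using norm_increment_le[OF x(1), of v] by (simp add: N_def d_def V_def S_def)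
      have CVW: "C * V * W \<ge> 0"
        using C_pos V segment_avg_w_nonneg by (simp add: W_def)
      have eN: "e x \<le> nD / 2 * N" using e_le[of x] by (simp add: N_def)
      have "(\<Sum>i<n. e2 i x) \<ge> - (1 + 2 * nA / c) * N"
        using energy_laplacian_ge[OF x(1) translate_in_Rn[of n v x]] e(2)[of x]
        by (simp add: d_def N_def sum_subtractf)
      moreover have "C * V * (\<Sum>i<n. segment_avg n v (w2 i) x) \<le> C * V * (B * W - 2 * c * S)"
        using sum_segment_avg_w2_le[of v x] C_pos V
        by (intro mult_left_mono) (simp_all add: B_def W_def S_def)
      \<comment> \<open>At these points \<open>C V W\<close> is below the energy, hence below a
        multiple of \<open>N\<close>, while \<open>V S \<ge> N\<close>; everything is thereby
        expressed through \<open>N\<close>.\<close>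
      moreover have "C * V * (B * W - 2 * c * S) \<le> B * (nD / 2 * N) - 2 * c * C * N"
      proof -
        have "B * (C * V * W) \<le> B * (nD / 2 * N)"
          using x(2) \<delta> eN B by (intro mult_left_mono) (auto simp: W_def)
        moreover have "2 * c * C * N \<le> 2 * c * C * (V * S)"
          using NS C_pos c_pos by (intro mult_left_mono) simp_all
        ultimately show ?thesis by (simp add: algebra_simps)
      qed
      moreover have "2 * c * C * N = (1 + 2 * nA / c) * N + B * (nD / 2 * N) + N"
        using c_pos by (simp add: C_def B_def field_simps)
      ultimately have "N \<le> (\<Sum>i<n. e2 i x - C * V * segment_avg n v (w2 i) x)"
        unfolding sum_subtractf sum_distrib_left[symmetric] by linarith
      moreover have "2 * \<delta> / (nD + 1) \<le> N"
      proof -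
        have "2 * \<delta> \<le> nD * N" using x(2) CVW eN by (simp add: W_def)
        also have "\<dots> \<le> N * (nD + 1)" by (simp add: N_def algebra_simps)
        finally show ?thesis using nD by (simp add: divide_le_eq)
      qed
      ultimately show ?thesis by linarith
    qed
  qed
  then have "e x0 - C * V * segment_avg n v w x0 \<le> 0"
    using field_le_epsilon[of "e x0 - C * V * segment_avg n v w x0" 0] by simp
  then show ?thesis by (simp add: e_def d_def V_def)
qed

section \<open>From increments to the gradient bound and rigidity\<close>

text \<open>The increment bound for \<open>h v\<close>, divided by \<open>h\<^sup>2\<close>: as
  \<open>h\<close> tends to 0 the left side becomes the energy of the directional derivative and the
  average of \<open>w\<close> tends to \<open>w x\<close>.\<close>

lemma directional_derivative_le:
  fixes v :: "nat \<Rightarrow> real"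
  assumes x: "x \<in> Rn n"
  defines "p \<equiv> \<Sum>i<n. v i *\<^sub>R u1 i x"
  shows "(D *v p) \<bullet> p / 2 \<le> C * (\<Sum>k<n. (v k)\<^sup>2) * w x"
proof -
  define q where "q h = u (translate n (\<lambda>k. h * v k) x)" for h
  define V where "V = (\<Sum>k<n. (v k)\<^sup>2)"
  have tr0: "translate n (\<lambda>k. 0 * v k) x = x"
    using x by (auto simp: translate_def fun_eq_iff PiE_iff extensional_def)
  have "(q has_vector_derivative p) (at 0)"
    using has_vector_derivative_along_line[OF D2 cont1, of v x 0]
    unfolding q_def p_def tr0 by simp
  then have "((\<lambda>h. (q h - q 0) /\<^sub>R h) \<longlongrightarrow> p) (at 0)"
  proof -
    assume q: "(q has_vector_derivative p) (at 0)"
    show ?thesis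
    proof (rule vec_tendstoI)
      fix j
      have "((\<lambda>h. q h $ j) has_real_derivative p $ j) (at 0)"
        using bounded_linear.has_vector_derivative[OF bounded_linear_vec_nth q]
        by (simp add: has_real_derivative_iff_has_vector_derivative)
      then show "((\<lambda>h. ((q h - q 0) /\<^sub>R h) $ j) \<longlongrightarrow> p $ j) (at 0)"
        by (simp add: has_field_derivative_iff divide_inverse mult.commute)
    qed
  qed
  then have lim1: "((\<lambda>h. (D *v ((q h - q 0) /\<^sub>R h)) \<bullet> ((q h - q 0) /\<^sub>R h) / 2) \<longlongrightarrow> (D *v p) \<bullet> p / 2) (at 0)"
    by (intro tendsto_divide tendsto_const bounded_bilinear.tendsto[OF bounded_bilinear_matrix]) simp_all
  have "isCont (\<lambda>h. segment_avg n (\<lambda>k. h * v k) w x) 0"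
    using continuous_on_segment_avg_scale[OF cont_w, of v x] by (simp add: continuous_on_eq_continuous_at)
  moreover have "segment_avg n (\<lambda>k. 0 * v k) w x = w x"
    using tr0 by (simp add: segment_avg_def)
  ultimately have "((\<lambda>h. segment_avg n (\<lambda>k. h * v k) w x) \<longlongrightarrow> w x) (at 0)"
    by (simp add: isCont_def)
  then have lim2: "((\<lambda>h. C * V * segment_avg n (\<lambda>k. h * v k) w x) \<longlongrightarrow> C * V * w x) (at 0)"
    by (intro tendsto_mult tendsto_const)
  have "(D *v ((q h - q 0) /\<^sub>R h)) \<bullet> ((q h - q 0) /\<^sub>R h) / 2 \<le> C * V * segment_avg n (\<lambda>k. h * v k) w x"
    if h: "h \<noteq> 0" for h
  proof -
    have "(D *v (q h - q 0)) \<bullet> (q h - q 0) / 2 \<le> C * (\<Sum>k<n. (h * v k)\<^sup>2) * segment_avg n (\<lambda>k. h * v k) w x"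
      using increment_le[OF x, of "\<lambda>k. h * v k"] unfolding q_def tr0 by simp
    also have "\<dots> = h\<^sup>2 * (C * V * segment_avg n (\<lambda>k. h * v k) w x)"
      by (simp add: V_def power_mult_distrib mult_ac flip: sum_distrib_left)
    finally have "(D *v (q h - q 0)) \<bullet> (q h - q 0) / 2 / h\<^sup>2 \<le> C * V * segment_avg n (\<lambda>k. h * v k) w x"
      using h by (simp add: divide_le_eq mult.commute)
    moreover have "(D *v (r /\<^sub>R h)) \<bullet> (r /\<^sub>R h) / 2 = (D *v r) \<bullet> r / 2 / h\<^sup>2" for r
      by (simp add: matrix_vector_mult_scaleR power2_eq_square inverse_eq_divide)
    ultimately show ?thesis by (simp only:)
  qed
  then have "\<forall>\<^sub>F h in at 0. (D *v ((q h - q 0) /\<^sub>R h)) \<bullet> ((q h - q 0) /\<^sub>R h) / 2 \<le>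
      C * V * segment_avg n (\<lambda>k. h * v k) w x"
    by (auto simp: eventually_at_filter)
  from tendsto_le[OF _ lim2 lim1 this] show ?thesis
    unfolding V_def by simp
qed

text \<open>The direction is the gradient of the component \<open>u\<^sup>j\<close> at
  \<open>x\<close>. Then both \<open>|v|\<^sup>2\<close> and component \<open>j\<close> of the
  directional derivative equal \<open>G\<close>, and one factor \<open>G\<close> cancels.\<close>

lemma gradient_le:
  assumes x: "x \<in> Rn n"
  shows "\<nu> $ j / 2 * (\<Sum>i<n. (u1 i x $ j)\<^sup>2) \<le> C * w x"
proof -
  define G where "G = (\<Sum>i<n. (u1 i x $ j)\<^sup>2)"
  define p where "p = (\<Sum>i<n. (u1 i x $ j) *\<^sub>R u1 i x)"
  have G: "G \<ge> 0" by (simp add: G_def sum_nonneg)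
  have "p $ j = G"
    by (simp add: p_def G_def power2_eq_square)
  then have "\<nu> $ j / 2 * G\<^sup>2 \<le> (D *v p) \<bullet> p / 2"
    using D_component_le[of j p] by simp
  also have "\<dots> \<le> C * G * w x"
    unfolding p_def G_def by (rule directional_derivative_le[OF x])
  finally have *: "(\<nu> $ j / 2 * G) * G \<le> (C * w x) * G"
    by (simp add: power2_eq_square mult_ac)
  show ?thesis
  proof (cases "G = 0")
    case True
    then show ?thesis using C_pos w_nonneg[OF x] by (simp add: G_def)
  next
    case False
    then show ?thesis using * G by (simp add: G_def)
  qed
qed

lemma constant_if_w_eq_0:
  assumes z: "z \<in> Rn n" "w z = 0"
  shows "u constant_on Rn n"
proof -
  have w0: "w x = 0" if x: "x \<in> Rn n" for x
  proof (rule ccontr)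
    assume "w x \<noteq> 0"
    then have "w x > 0" using w_nonneg[OF x] by simp
    moreover have "(\<Sum>i<n. w2 i y) \<le> 2 * nA * nDi / c * w y" if y: "y \<in> Rn n" for y
    proof -
      have "0 \<le> 2 * c * (\<Sum>i<n. (norm (u1 i y))\<^sup>2)"
        using c_pos by (simp add: sum_nonneg)
      then show ?thesis
        using lap_w_le[OF y] mult_right_mono[OF b_le[OF y] w_nonneg[OF y]] by linarith
    qed
    ultimately have "w z > 0"
      using nonneg_supersolution_pos[OF cont_w D2_w w_nonneg _ x _ z(1)] by blast
    then show False using z(2) by simp
  qed
  \<comment> \<open>Any two points are joined by a translation; with \<open>w\<close> zero along the
    segment, the energy of the increment vanishes.\<close>
  have "u y = u z" if y: "y \<in> Rn n" for y
  proof -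
    define v where "v k = y k - z k" for k
    have tr: "translate n v z = y"
      using y z(1) by (auto simp: translate_def v_def fun_eq_iff PiE_iff extensional_def)
    have "segment_avg n v w z = 0"
      by (simp add: segment_avg_def w0)
    then have "(D *v (u y - u z)) \<bullet> (u y - u z) \<le> 0"
      using increment_le[OF z(1), of v] by (simp add: tr)
    from eq_0_if_D_nonpos[OF this] show ?thesis by simp
  qed
  then show ?thesis unfolding constant_on_def by blast
qed

end

section \<open>From the stated hypotheses to the locale\<close>

text \<open>\<open>matrix_inv\<close> is a choice among two-sided inverses, so uniqueness of the
  inverse has to be shown as well.\<close>

lemma matrix_inv_diag:
  assumes "\<And>j. \<nu> $ j \<noteq> 0"
  shows "matrix_inv (diag \<nu>) = diag (\<chi> j. 1 / \<nu> $ j)"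
proof -
  have inv: "diag \<nu> ** diag (\<chi> j. 1 / \<nu> $ j) = mat 1" "diag (\<chi> j. 1 / \<nu> $ j) ** diag \<nu> = mat 1"
    unfolding matrix_eq using assms by (simp_all add: vec_eq_iff flip: matrix_vector_mul_assoc)
  show ?thesis
    unfolding matrix_inv_def
  proof (rule some_equality)
    fix B assume B: "diag \<nu> ** B = mat 1 \<and> B ** diag \<nu> = mat 1"
    have "B = B ** (diag \<nu> ** diag (\<chi> j. 1 / \<nu> $ j))"
      unfolding inv by simp
    also have "\<dots> = diag (\<chi> j. 1 / \<nu> $ j)"
      unfolding matrix_mul_assoc using B by simp
    finally show "B = diag (\<chi> j. 1 / \<nu> $ j)" .
  qed (simp add: inv)
qed

lemma Ck_2D:
  assumes "Ck n 2 f"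
  shows "continuous_on (Rn n) f"
    and "\<And>i. i < n \<Longrightarrow> continuous_on (Rn n) (partial i f)"
    and "\<And>i. i < n \<Longrightarrow> continuous_on (Rn n) (partial i (partial i f))"
    and "partials2 n f (\<lambda>i. partial i f) (\<lambda>i. partial i (partial i f))"
proof -
  have f: "continuous_on (Rn n) f"
    "\<And>i x. i < n \<Longrightarrow> x \<in> Rn n \<Longrightarrow> (\<lambda>t. f (x(i := t))) field_differentiable (at (x i))"
    "\<And>i. i < n \<Longrightarrow> continuous_on (Rn n) (partial i f)"
    "\<And>i x. i < n \<Longrightarrow> x \<in> Rn n \<Longrightarrow> (\<lambda>t. partial i f (x(i := t))) field_differentiable (at (x i))"
    "\<And>i. i < n \<Longrightarrow> continuous_on (Rn n) (partial i (partial i f))"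
    using assms by (simp_all add: numeral_2_eq_2 continuous_on_Rn_iff)
  show "continuous_on (Rn n) f" by (rule f)
  show "continuous_on (Rn n) (partial i f)" if "i < n" for i by (rule f(3)[OF that])
  show "continuous_on (Rn n) (partial i (partial i f))" if "i < n" for i by (rule f(5)[OF that])
  show "partials2 n f (\<lambda>i. partial i f) (\<lambda>i. partial i (partial i f))"
    unfolding partials2_def
  proof (intro ballI allI impI conjI)
    fix x i assume x: "x \<in> Rn n" and i: "i < n"
    show "((\<lambda>t. f (x(i := t))) has_vector_derivative partial i f x) (at (x i))"
      using f(2)[OF i x] unfolding partial_def
      by (simp add: field_differentiable_derivI flip: has_real_derivative_iff_has_vector_derivative)
    show "((\<lambda>t. partial i f (x(i := t))) has_vector_derivative partial i (partial i f) x) (at (x i))"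
      using f(4)[OF i x] unfolding partial_def[of i "partial i f"]
      by (simp add: field_differentiable_derivI flip: has_real_derivative_iff_has_vector_derivative)
  qed
qed

lemma has_vector_derivative_vec:
  fixes f :: "real \<Rightarrow> real ^ 'm"
  assumes "\<And>j. ((\<lambda>t. f t $ j) has_vector_derivative f' $ j) (at t)"
  shows "(f has_vector_derivative f') (at t)"
  unfolding has_vector_derivative_def
proof (subst has_derivative_componentwise_within, rule ballI)
  fix e :: "real ^ 'm" assume "e \<in> Basis"
  then obtain j where "e = axis j 1" by (auto simp: Basis_vec_def)
  then show "((\<lambda>t. f t \<bullet> e) has_derivative (\<lambda>h. (h *\<^sub>R f') \<bullet> e)) (at t)"
    using assms[of j] by (simp add: has_vector_derivative_def inner_axis)
qed

lemma partials2_vec: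
  fixes u :: "(nat \<Rightarrow> real) \<Rightarrow> real ^ 'm"
  assumes "\<And>j. partials2 n (\<lambda>x. u x $ j) (\<lambda>i x. u1 i x $ j) (\<lambda>i x. u2 i x $ j)"
  shows "partials2 n u u1 u2"
  using assms unfolding partials2_def by (blast intro: has_vector_derivative_vec)

theorem theorem3p1:
  fixes \<nu> :: "real ^ 'm" and D A :: "real ^ 'm ^ 'm"
  assumes "D = diag \<nu>" and "\<forall>i. \<nu> $ i > 0"
    and "\<forall>v. ((matrix_inv D ** A + A ** matrix_inv D) *v v) \<bullet> v \<ge> 0"
    and "\<exists>c>0. \<forall>v. (A *v v) \<bullet> v \<ge> c * (norm v)\<^sup>2"
  shows "\<exists>C :: real \<Rightarrow> real. (\<forall>M. C M > 0) \<and>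
    (\<forall>n \<ge> 1. \<forall>u :: (nat \<Rightarrow> real) \<Rightarrow> real ^ 'm.
       (\<forall>j. Ck n 2 (\<lambda>x. u x $ j)) \<and> Linf n u \<and>
       (\<forall>x\<in>Rn n. D *v vec_laplacian n u x + (1 - (A *v u x) \<bullet> u x) *\<^sub>R u x = 0)
       \<longrightarrow>
       (\<forall>x\<in>Rn n. (\<Sum>j\<in>UNIV. \<nu> $ j / 2 * (L2_set (grad n (\<lambda>y. u y $ j) x) {..<n})\<^sup>2)
                  \<le> C (Linf_norm n u) * (1 - (A *v u x) \<bullet> u x)) \<and>
       (\<forall>x\<in>Rn n. (A *v u x) \<bullet> u x \<le> 1) \<and>
       (\<not> u constant_on Rn n \<longrightarrow> (\<forall>x\<in>Rn n. (A *v u x) \<bullet> u x < 1)))"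
proof -
  from assms(4) obtain c where c: "c > 0" "\<And>v. (A *v v) \<bullet> v \<ge> c * (norm v)\<^sup>2"
    by blast
  have \<nu>: "\<And>j. \<nu> $ j > 0" using assms(2) by simp
  then have nz: "\<nu> $ j \<noteq> 0" for j by (metis less_irrefl)
  have sym: "(A *v (diag (\<chi> j. 1 / \<nu> $ j) *v v)) \<bullet> v + (A *v v) \<bullet> (diag (\<chi> j. 1 / \<nu> $ j) *v v) \<ge> 0" for v
  proof -
    have "0 \<le> ((diag (\<chi> j. 1 / \<nu> $ j) ** A + A ** diag (\<chi> j. 1 / \<nu> $ j)) *v v) \<bullet> v"
      using assms(3)[rule_format, of v] unfolding assms(1) matrix_inv_diag[OF nz] .
    also have "\<dots> = (A *v (diag (\<chi> j. 1 / \<nu> $ j) *v v)) \<bullet> v + (diag (\<chi> j. 1 / \<nu> $ j) *v (A *v v)) \<bullet> v"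
      by (simp add: matrix_vector_mult_add_rdistrib inner_add_left flip: matrix_vector_mul_assoc)
    also have "(diag (\<chi> j. 1 / \<nu> $ j) *v (A *v v)) \<bullet> v = (A *v v) \<bullet> (diag (\<chi> j. 1 / \<nu> $ j) *v v)"
      using diag_inner_commute[of "\<chi> j. 1 / \<nu> $ j" "A *v v" v] by (simp add: inner_commute)
    finally show ?thesis .
  qed
  \<comment> \<open>The factor \<open>CARD('m)\<close> pays for summing the bounds of the single
    components. \<open>C\<close> depends only on \<open>A\<close>, \<open>\<nu>\<close> and
    \<open>c\<close>, fixed before \<open>n\<close> and \<open>u\<close>; the maximum with 1 makes
    positivity evident outside the locale.\<close>
  define K where "K = max 1 (real CARD('m) * competition_system.C A \<nu> c)"
  have main: "(\<forall>x\<in>Rn n. (\<Sum>j\<in>UNIV. \<nu> $ j / 2 * (L2_set (grad n (\<lambda>y. u y $ j) x) {..<n})\<^sup>2)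
                  \<le> K * (1 - (A *v u x) \<bullet> u x)) \<and>
       (\<forall>x\<in>Rn n. (A *v u x) \<bullet> u x \<le> 1) \<and>
       (\<not> u constant_on Rn n \<longrightarrow> (\<forall>x\<in>Rn n. (A *v u x) \<bullet> u x < 1))"
    if Ck: "\<And>j. Ck n 2 (\<lambda>x. u x $ j)" and Linf: "Linf n u"
      and eq: "\<And>x. x \<in> Rn n \<Longrightarrow> D *v vec_laplacian n u x + (1 - (A *v u x) \<bullet> u x) *\<^sub>R u x = 0"
    for n and u :: "(nat \<Rightarrow> real) \<Rightarrow> real ^ 'm"
  proof -
    define u1 where "u1 i x = (\<chi> j. partial i (\<lambda>y. u y $ j) x)" for i x
    define u2 where "u2 i x = (\<chi> j. partial i (partial i (\<lambda>y. u y $ j)) x)" for i x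
    have cont: "continuous_on (Rn n) u"
      using continuous_on_vec_lambda[of "Rn n" "\<lambda>j x. u x $ j"] Ck_2D(1)[OF Ck] by simp
    interpret competition_system A \<nu> c n u u1 u2
    proof
      show "continuous_on (Rn n) u" by (rule cont)
      show "partials2 n u u1 u2"
        by (rule partials2_vec) (simp add: u1_def u2_def Ck_2D(4)[OF Ck])
      show "continuous_on (Rn n) (u1 i)" "continuous_on (Rn n) (u2 i)" if "i < n" for i
        unfolding u1_def[abs_def] u2_def[abs_def]
        by (intro continuous_on_vec_lambda Ck_2D(2,3)[OF Ck that])+
      show "\<exists>M. \<forall>x\<in>Rn n. norm (u x) \<le> M"
        by (rule continuous_bounded_if_Linf[OF cont Linf])
      show "(\<Sum>i<n. u2 i x) = - ((1 - (A *v u x) \<bullet> u x) *\<^sub>R (diag (\<chi> j. 1 / \<nu> $ j) *v u x))"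
        if x: "x \<in> Rn n" for x
      proof -
        have "(\<Sum>i<n. u2 i x) $ j = - ((1 - (A *v u x) \<bullet> u x) * (u x $ j / \<nu> $ j))" for j
        proof -
          have "\<nu> $ j * (\<Sum>i<n. u2 i x) $ j + (1 - (A *v u x) \<bullet> u x) * u x $ j = 0"
            using arg_cong[OF eq[OF x], of "\<lambda>v. v $ j"]
            by (simp add: assms(1) vec_laplacian_def laplacian_def u2_def)
          then show ?thesis using nz[of j] by (simp add: field_simps eq_neg_iff_add_eq_0)
        qed
        then show ?thesis by (simp add: vec_eq_iff)
      qed
    qed (use \<nu> sym c in auto)
    have "(\<Sum>j\<in>UNIV. \<nu> $ j / 2 * (L2_set (grad n (\<lambda>y. u y $ j) x) {..<n})\<^sup>2) \<le> K * (1 - (A *v u x) \<bullet> u x)"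
      if x: "x \<in> Rn n" for x
    proof -
      have "\<nu> $ j / 2 * (L2_set (grad n (\<lambda>y. u y $ j) x) {..<n})\<^sup>2 \<le> C * w x" for j
      proof -
        have "(L2_set (grad n (\<lambda>y. u y $ j) x) {..<n})\<^sup>2 = (\<Sum>i<n. (u1 i x $ j)\<^sup>2)"
          by (simp add: L2_set_def grad_def u1_def sum_nonneg)
        then show ?thesis using gradient_le[OF x, of j] by simp
      qed
      then have "(\<Sum>j\<in>UNIV. \<nu> $ j / 2 * (L2_set (grad n (\<lambda>y. u y $ j) x) {..<n})\<^sup>2) \<le> (\<Sum>j\<in>(UNIV :: 'm set). C * w x)"
        by (rule sum_mono)
      also have "\<dots> = (real CARD('m) * C) * w x" by simp
      also have "\<dots> \<le> K * w x"
        unfolding K_def by (intro mult_right_mono w_nonneg[OF x]) simp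
      finally show ?thesis by (simp add: w_def)
    qed
    moreover have "(A *v u x) \<bullet> u x \<le> 1" if "x \<in> Rn n" for x
      using w_nonneg[OF that] by (simp add: w_def)
    moreover have "(A *v u x) \<bullet> u x < 1" if "\<not> u constant_on Rn n" "x \<in> Rn n" for x
      using constant_if_w_eq_0[OF that(2)] w_nonneg[OF that(2)] that(1) by (fastforce simp: w_def)
    ultimately show ?thesis by blast
  qed
  have K: "K > 0" by (simp add: K_def)
  show ?thesis
  \<comment> \<open>The witness is constant in the sup norm, since \<open>w \<ge> 0\<close> already
    bounds \<open>u\<close> in terms of \<open>c\<close>.\<close>
  proof (intro exI[of _ "\<lambda>_. K"] conjI[OF allI[OF K]] allI impI)
    fix n and u :: "(nat \<Rightarrow> real) \<Rightarrow> real ^ 'm"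
    assume u: "(\<forall>j. Ck n 2 (\<lambda>x. u x $ j)) \<and> Linf n u \<and>
      (\<forall>x\<in>Rn n. D *v vec_laplacian n u x + (1 - (A *v u x) \<bullet> u x) *\<^sub>R u x = 0)"
    show "(\<forall>x\<in>Rn n. (\<Sum>j\<in>UNIV. \<nu> $ j / 2 * (L2_set (grad n (\<lambda>y. u y $ j) x) {..<n})\<^sup>2)
                  \<le> K * (1 - (A *v u x) \<bullet> u x)) \<and>
       (\<forall>x\<in>Rn n. (A *v u x) \<bullet> u x \<le> 1) \<and>
       (\<not> u constant_on Rn n \<longrightarrow> (\<forall>x\<in>Rn n. (A *v u x) \<bullet> u x < 1))"
      by (rule main) (simp_all add: u)
  qed
qed

end
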